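(* Let $A$ and $B$ be rings, let $(A,B,M,N,\psi,\varphi)$ be a Morita context, and let $T$ be the ring of this Morita context. If $\operatorname{im}(\psi)$ and $\operatorname{im}(\varphi)$ are nilpotent, then $A$ and $B$ are both periodic if and only if $T$ is periodic.
   Context: All rings are associative with identity. A ring $R$ is periodic if for every $a\in R$ there exist distinct positive integers $m,n$ with $a^m=a^n$. A Morita context $(A,B,M,N,\psi,\varphi)$ consists of two rings $A,B$, two bimodules ${}_AN_B$ and ${}_BM_A$, and bimodule homomorphisms $\psi:N\otimes_B M\to A$ and $\varphi:M\otimes_A N\to B$ satisfying $\psi(n\otimes m)n'=n\varphi(m\otimes n')$ and $\varphi(m\otimes n)m'=m\psi(n\otimes m')$ for all $m,m'\in M$, $n,n'\in N$. The ring of the Morita context is the set $T$ of generalized matrices $\begin{pmatrix}a&n\\ m&b\end{pmatrix}$ with $a\in A$, $b\in B$, $m\in M$, $n\in N$, with componentwise addition and multiplication $$\begin{pmatrix}a_1&n_1\\ m_1&b_1\end{pmatrix}\begin{pmatrix}a_2&n_2\\ m_2&b_2\end{pmatrix}=\begin{pmatrix}a_1a_2+\psi(n_1\otimes m_2)&a_1n_2+n_1b_2\\ m_1a_2+b_1m_2&\varphi(m_1\otimes n_2)+b_1b_2\end{pmatrix}.$$ The images $\operatorname{im}(\psi)$ and $\operatorname{im}(\varphi)$ are two-sided ideals of $A$ and $B$ respectively; an ideal $I$ is nilpotent if $I^k=0$ for some positive integer $k$. *)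

theory Defs
  imports "HOL-Algebra.Module" "HOL-Algebra.Ideal_Product" "HOL-Algebra.Free_Abelian_Groups"
begin

text \<open>
  The rings of HOL-Algebra are associative with identity and not assumed commutative; the zero
  ring is allowed. The exponentiation is that of the multiplicative monoid of the ring.
\<close>

locale periodic_ring = ring +
  assumes periodic:
    "a \<in> carrier R \<Longrightarrow> \<exists>m n :: nat. 0 < m \<and> 0 < n \<and> m \<noteq> n \<and> a [^] m = a [^] n"

primrec ideal_power :: "('a, 'b) ring_scheme \<Rightarrow> 'a set \<Rightarrow> nat \<Rightarrow> 'a set" where
  "ideal_power R I 0 = carrier R"
| "ideal_power R I (Suc k) = ideal_prod R (ideal_power R I k) I"

definition nilpotent_ideal :: "('a, 'b) ring_scheme \<Rightarrow> 'a set \<Rightarrow> bool" where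
  "nilpotent_ideal R I \<longleftrightarrow> (\<exists>k>0. ideal_power R I k = {\<zero>\<^bsub>R\<^esub>})"


section \<open>Bimodules\<close>

text \<open>
  As with the library's records of modules, the fields \<open>mult\<close> and \<open>one\<close> inherited from the records
  of rings are irrelevant.
\<close>

record ('a, 'b, 'c) bimodule = "('a, 'c) module" +
  rsmult :: "['c, 'b] \<Rightarrow> 'c"  (infixl \<open>\<odot>r\<index>\<close> 70)

locale bimodule = R?: ring R + S?: ring S + V?: abelian_group V
  for R :: "('a, 'r) ring_scheme" (structure) and S :: "('b, 's) ring_scheme" (structure)
    and V :: "('a, 'b, 'c, 'x) bimodule_scheme" (structure) +
  assumes smult_closed [simp, intro]:
      "\<lbrakk> a \<in> carrier R; x \<in> carrier V \<rbrakk> \<Longrightarrow> a \<odot>\<^bsub>V\<^esub> x \<in> carrier V"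
    and smult_l_distr:
      "\<lbrakk> a \<in> carrier R; b \<in> carrier R; x \<in> carrier V \<rbrakk> \<Longrightarrow>
        (a \<oplus>\<^bsub>R\<^esub> b) \<odot>\<^bsub>V\<^esub> x = (a \<odot>\<^bsub>V\<^esub> x) \<oplus>\<^bsub>V\<^esub> (b \<odot>\<^bsub>V\<^esub> x)"
    and smult_r_distr:
      "\<lbrakk> a \<in> carrier R; x \<in> carrier V; y \<in> carrier V \<rbrakk> \<Longrightarrow>
        a \<odot>\<^bsub>V\<^esub> (x \<oplus>\<^bsub>V\<^esub> y) = (a \<odot>\<^bsub>V\<^esub> x) \<oplus>\<^bsub>V\<^esub> (a \<odot>\<^bsub>V\<^esub> y)"
    and smult_assoc:
      "\<lbrakk> a \<in> carrier R; b \<in> carrier R; x \<in> carrier V \<rbrakk> \<Longrightarrow>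
        (a \<otimes>\<^bsub>R\<^esub> b) \<odot>\<^bsub>V\<^esub> x = a \<odot>\<^bsub>V\<^esub> (b \<odot>\<^bsub>V\<^esub> x)"
    and smult_one [simp]:
      "x \<in> carrier V \<Longrightarrow> \<one>\<^bsub>R\<^esub> \<odot>\<^bsub>V\<^esub> x = x"
    and rsmult_closed [simp, intro]:
      "\<lbrakk> x \<in> carrier V; s \<in> carrier S \<rbrakk> \<Longrightarrow> x \<odot>r\<^bsub>V\<^esub> s \<in> carrier V"
    and rsmult_l_distr:
      "\<lbrakk> x \<in> carrier V; y \<in> carrier V; s \<in> carrier S \<rbrakk> \<Longrightarrow>
        (x \<oplus>\<^bsub>V\<^esub> y) \<odot>r\<^bsub>V\<^esub> s = (x \<odot>r\<^bsub>V\<^esub> s) \<oplus>\<^bsub>V\<^esub> (y \<odot>r\<^bsub>V\<^esub> s)"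
    and rsmult_r_distr:
      "\<lbrakk> x \<in> carrier V; s \<in> carrier S; t \<in> carrier S \<rbrakk> \<Longrightarrow>
        x \<odot>r\<^bsub>V\<^esub> (s \<oplus>\<^bsub>S\<^esub> t) = (x \<odot>r\<^bsub>V\<^esub> s) \<oplus>\<^bsub>V\<^esub> (x \<odot>r\<^bsub>V\<^esub> t)"
    and rsmult_assoc:
      "\<lbrakk> x \<in> carrier V; s \<in> carrier S; t \<in> carrier S \<rbrakk> \<Longrightarrow>
        x \<odot>r\<^bsub>V\<^esub> (s \<otimes>\<^bsub>S\<^esub> t) = (x \<odot>r\<^bsub>V\<^esub> s) \<odot>r\<^bsub>V\<^esub> t"
    and rsmult_one [simp]:
      "x \<in> carrier V \<Longrightarrow> x \<odot>r\<^bsub>V\<^esub> \<one>\<^bsub>S\<^esub> = x"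
    and smult_rsmult:
      "\<lbrakk> a \<in> carrier R; x \<in> carrier V; s \<in> carrier S \<rbrakk> \<Longrightarrow>
        (a \<odot>\<^bsub>V\<^esub> x) \<odot>r\<^bsub>V\<^esub> s = a \<odot>\<^bsub>V\<^esub> (x \<odot>r\<^bsub>V\<^esub> s)"

definition regular_bimodule :: "('a, 'r) ring_scheme \<Rightarrow> ('a, 'a, 'a) bimodule" where
  "regular_bimodule R =
    \<lparr> carrier = carrier R, monoid.mult = monoid.mult R, one = one R, ring.zero = ring.zero R, add = add R,
      smult = monoid.mult R, rsmult = monoid.mult R \<rparr>"

definition bimodule_hom ::
    "('a, 'r) ring_scheme \<Rightarrow> ('b, 's) ring_scheme \<Rightarrow> ('a, 'b, 'c, 'x) bimodule_scheme
      \<Rightarrow> ('a, 'b, 'd, 'y) bimodule_scheme \<Rightarrow> ('c \<Rightarrow> 'd) set" where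
  "bimodule_hom R S V W = {f \<in> carrier V \<rightarrow> carrier W.
      (\<forall>x \<in> carrier V. \<forall>y \<in> carrier V. f (x \<oplus>\<^bsub>V\<^esub> y) = f x \<oplus>\<^bsub>W\<^esub> f y) \<and>
      (\<forall>a \<in> carrier R. \<forall>x \<in> carrier V. f (a \<odot>\<^bsub>V\<^esub> x) = a \<odot>\<^bsub>W\<^esub> f x) \<and>
      (\<forall>x \<in> carrier V. \<forall>s \<in> carrier S. f (x \<odot>r\<^bsub>V\<^esub> s) = f x \<odot>r\<^bsub>W\<^esub> s)}"


section \<open>Tensor products of bimodules\<close>

text \<open>
  For an \<open>R\<close>-\<open>S\<close>-bimodule \<open>V\<close> and an \<open>S\<close>-\<open>P\<close>-bimodule \<open>W\<close>, the tensor product over \<open>S\<close> is the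
  quotient of the free abelian group on \<open>carrier V \<times> carrier W\<close> by the subgroup generated by the
  usual relations. Its elements are the cosets of that subgroup.
\<close>

abbreviation tensor_free ::
    "('a, 'b, 'c, 'x) bimodule_scheme \<Rightarrow> ('b, 'e, 'd, 'y) bimodule_scheme
      \<Rightarrow> (('c \<times> 'd) \<Rightarrow>\<^sub>0 int) monoid" where
  "tensor_free V W \<equiv> free_Abelian_group (carrier V \<times> carrier W)"

definition tensor_rel ::
    "('b, 's) ring_scheme \<Rightarrow> ('a, 'b, 'c, 'x) bimodule_scheme
      \<Rightarrow> ('b, 'e, 'd, 'y) bimodule_scheme \<Rightarrow> (('c \<times> 'd) \<Rightarrow>\<^sub>0 int) set" where
  "tensor_rel S V W = generate (tensor_free V W)
    ({frag_of (x \<oplus>\<^bsub>V\<^esub> x', y) - frag_of (x, y) - frag_of (x', y) | x x' y.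
        x \<in> carrier V \<and> x' \<in> carrier V \<and> y \<in> carrier W} \<union>
     {frag_of (x, y \<oplus>\<^bsub>W\<^esub> y') - frag_of (x, y) - frag_of (x, y') | x y y'.
        x \<in> carrier V \<and> y \<in> carrier W \<and> y' \<in> carrier W} \<union>
     {frag_of (x \<odot>r\<^bsub>V\<^esub> s, y) - frag_of (x, s \<odot>\<^bsub>W\<^esub> y) | x s y.
        x \<in> carrier V \<and> s \<in> carrier S \<and> y \<in> carrier W})"

text \<open>
  The actions are those induced by \<open>a (x \<otimes> y) = (a x) \<otimes> y\<close> and \<open>(x \<otimes> y) p = x \<otimes> (y p)\<close>: the
  additive extension to the free abelian group maps a coset \<open>C\<close> of the subgroup of relations into
  a single coset, and adding that subgroup to the image of \<open>C\<close> yields all of the latter.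
\<close>

definition tensor_product ::
    "('b, 's) ring_scheme \<Rightarrow> ('a, 'b, 'c, 'x) bimodule_scheme
      \<Rightarrow> ('b, 'e, 'd, 'y) bimodule_scheme \<Rightarrow> ('a, 'e, (('c \<times> 'd) \<Rightarrow>\<^sub>0 int) set) bimodule" where
  "tensor_product S V W =
    (let F = tensor_free V W; H = tensor_rel S V W in
    \<lparr> carrier = carrier (F Mod H),
      monoid.mult = undefined, one = undefined,
      ring.zero = \<one>\<^bsub>F Mod H\<^esub>,
      add = monoid.mult (F Mod H),
      smult = (\<lambda>a C. H <#>\<^bsub>F\<^esub> (frag_extend (\<lambda>(x, y). frag_of (a \<odot>\<^bsub>V\<^esub> x, y)) ` C)),
      rsmult = (\<lambda>C p. H <#>\<^bsub>F\<^esub> (frag_extend (\<lambda>(x, y). frag_of (x, y \<odot>r\<^bsub>W\<^esub> p)) ` C)) \<rparr>)"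

definition pure_tensor ::
    "('b, 's) ring_scheme \<Rightarrow> ('a, 'b, 'c, 'x) bimodule_scheme
      \<Rightarrow> ('b, 'e, 'd, 'y) bimodule_scheme \<Rightarrow> 'c \<Rightarrow> 'd \<Rightarrow> (('c \<times> 'd) \<Rightarrow>\<^sub>0 int) set" where
  "pure_tensor S V W x y = tensor_rel S V W #>\<^bsub>tensor_free V W\<^esub> frag_of (x, y)"


section \<open>Morita contexts\<close>

locale morita_context = A?: ring A + B?: ring B + M?: bimodule B A M + N?: bimodule A B N
  for A :: "('a, 'r) ring_scheme" and B :: "('b, 's) ring_scheme"
    and M :: "('b, 'a, 'm, 'x) bimodule_scheme" and N :: "('a, 'b, 'n, 'y) bimodule_scheme"
    and \<psi> :: "(('n \<times> 'm) \<Rightarrow>\<^sub>0 int) set \<Rightarrow> 'a" and \<phi> :: "(('m \<times> 'n) \<Rightarrow>\<^sub>0 int) set \<Rightarrow> 'b" +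
  assumes psi_hom: "\<psi> \<in> bimodule_hom A A (tensor_product B N M) (regular_bimodule A)"
    and phi_hom: "\<phi> \<in> bimodule_hom B B (tensor_product A M N) (regular_bimodule B)"
    and psi_phi: "\<lbrakk> m \<in> carrier M; n \<in> carrier N; n' \<in> carrier N \<rbrakk> \<Longrightarrow>
      \<psi> (pure_tensor B N M n m) \<odot>\<^bsub>N\<^esub> n' = n \<odot>r\<^bsub>N\<^esub> \<phi> (pure_tensor A M N m n')"
    and phi_psi: "\<lbrakk> m \<in> carrier M; n \<in> carrier N; m' \<in> carrier M \<rbrakk> \<Longrightarrow>
      \<phi> (pure_tensor A M N m n) \<odot>\<^bsub>M\<^esub> m' = m \<odot>r\<^bsub>M\<^esub> \<psi> (pure_tensor B N M n m')"

text \<open>The tuple \<open>(a, n, m, b)\<close> stands for the generalized matrix with rows \<open>a n\<close> and \<open>m b\<close>.\<close>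

definition morita_ring ::
    "('a, 'r) ring_scheme \<Rightarrow> ('b, 's) ring_scheme \<Rightarrow> ('b, 'a, 'm, 'x) bimodule_scheme
      \<Rightarrow> ('a, 'b, 'n, 'y) bimodule_scheme \<Rightarrow> ((('n \<times> 'm) \<Rightarrow>\<^sub>0 int) set \<Rightarrow> 'a)
      \<Rightarrow> ((('m \<times> 'n) \<Rightarrow>\<^sub>0 int) set \<Rightarrow> 'b) \<Rightarrow> ('a \<times> 'n \<times> 'm \<times> 'b) ring" where
  "morita_ring A B M N \<psi> \<phi> =
    \<lparr> carrier = carrier A \<times> carrier N \<times> carrier M \<times> carrier B,
      monoid.mult = (\<lambda>(a1, n1, m1, b1) (a2, n2, m2, b2).
        (a1 \<otimes>\<^bsub>A\<^esub> a2 \<oplus>\<^bsub>A\<^esub> \<psi> (pure_tensor B N M n1 m2),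
         (a1 \<odot>\<^bsub>N\<^esub> n2) \<oplus>\<^bsub>N\<^esub> (n1 \<odot>r\<^bsub>N\<^esub> b2),
         (m1 \<odot>r\<^bsub>M\<^esub> a2) \<oplus>\<^bsub>M\<^esub> (b1 \<odot>\<^bsub>M\<^esub> m2),
         \<phi> (pure_tensor A M N m1 n2) \<oplus>\<^bsub>B\<^esub> b1 \<otimes>\<^bsub>B\<^esub> b2)),
      one = (\<one>\<^bsub>A\<^esub>, \<zero>\<^bsub>N\<^esub>, \<zero>\<^bsub>M\<^esub>, \<one>\<^bsub>B\<^esub>),
      ring.zero = (\<zero>\<^bsub>A\<^esub>, \<zero>\<^bsub>N\<^esub>, \<zero>\<^bsub>M\<^esub>, \<zero>\<^bsub>B\<^esub>),
      add = (\<lambda>(a1, n1, m1, b1) (a2, n2, m2, b2).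
        (a1 \<oplus>\<^bsub>A\<^esub> a2, n1 \<oplus>\<^bsub>N\<^esub> n2, m1 \<oplus>\<^bsub>M\<^esub> m2, b1 \<oplus>\<^bsub>B\<^esub> b2)) \<rparr>"

end

theory Submission
  imports Defs
begin

text \<open>
  Write \<open>I\<close> and \<open>J\<close> for the additive spans of the values of the two pairings. If \<open>A\<close> and \<open>B\<close> are
  periodic, then for \<open>t\<close> in \<open>T\<close> there are \<open>r < s\<close> such that \<open>w = t\<^sup>s - t\<^sup>r\<close> has its diagonal entries in
  \<open>I\<close> and \<open>J\<close>. Every two right multiplications by such a \<open>w\<close> push the diagonal entries into the next
  powers of \<open>I\<close> and \<open>J\<close>, so \<open>w\<close> is nilpotent. A periodic ring has positive characteristic, because
  some power of \<open>2\<close> is repeated, so \<open>T\<close> has positive characteristic \<open>c\<close>. Since \<open>x = t\<^sup>r\<close> and \<open>w\<close> commute, the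
  binomial theorem gives \<open>(x + w)\<^sup>c = x\<^sup>c + w\<^sup>2u\<close> with \<open>u\<close> commuting with both, and iterating this
  removes \<open>w\<close>: with \<open>e\<close> a large power of \<open>c\<close>, \<open>t\<close> has equal \<open>se\<close>-th and \<open>re\<close>-th powers.
  Conversely, the diagonal of \<open>T\<close> contains copies of \<open>A\<close> and \<open>B\<close>.
\<close>

section \<open>Pure tensors\<close>

locale bimodule_pair = V: bimodule R S V + W: bimodule S P W
  for R :: "('a, 'r) ring_scheme" and S :: "('b, 's) ring_scheme" and P :: "('e, 'p) ring_scheme"
    and V :: "('a, 'b, 'c, 'x) bimodule_scheme" and W :: "('b, 'e, 'd, 'y) bimodule_scheme"
begin

text \<open>The bimodule operations are closed, so every generator is supported on pairs from
  \<open>carrier V\<close> and \<open>carrier W\<close> and lies in the free abelian group.\<close>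

lemma subgroup_tensor_rel: "subgroup (tensor_rel S V W) (tensor_free V W)"
  unfolding tensor_rel_def
proof (rule group.generate_is_subgroup[OF group_free_Abelian_group], rule subsetI, erule UnE, erule UnE)
qed (auto dest!: subsetD[OF keys_diff])

text \<open>Cosets are computed below with \<open>+\<close> and \<open>-\<close> of finitely
  supported functions. The group inverse agrees with \<open>-\<close> on the carrier, so that
  inclusion is supplied as well.\<close>

lemma tensor_rel_closed:
  shows zero_in_tensor_rel: "0 \<in> tensor_rel S V W"
    and add_in_tensor_rel: "\<lbrakk>u \<in> tensor_rel S V W; v \<in> tensor_rel S V W\<rbrakk> \<Longrightarrow> u + v \<in> tensor_rel S V W"
    and minus_in_tensor_rel: "u \<in> tensor_rel S V W \<Longrightarrow> - u \<in> tensor_rel S V W"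
  using subgroup.one_closed[OF subgroup_tensor_rel] subgroup.m_closed[OF subgroup_tensor_rel]
    subgroup.m_inv_closed[OF subgroup_tensor_rel] subgroup.subset[OF subgroup_tensor_rel]
  by (auto simp: subset_iff)

lemma
  assumes "x \<in> carrier V" "y \<in> carrier W"
  shows tensor_rel_add_left: "x' \<in> carrier V
        \<Longrightarrow> frag_of (x \<oplus>\<^bsub>V\<^esub> x', y) - frag_of (x, y) - frag_of (x', y) \<in> tensor_rel S V W"
    and tensor_rel_add_right: "y' \<in> carrier W
        \<Longrightarrow> frag_of (x, y \<oplus>\<^bsub>W\<^esub> y') - frag_of (x, y) - frag_of (x, y') \<in> tensor_rel S V W"
    and tensor_rel_balanced: "s \<in> carrier S
        \<Longrightarrow> frag_of (x \<odot>r\<^bsub>V\<^esub> s, y) - frag_of (x, s \<odot>\<^bsub>W\<^esub> y) \<in> tensor_rel S V W"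
  unfolding tensor_rel_def using assms by - (rule generate.incl, blast)+

lemma tensor_coset_eq: "tensor_rel S V W #>\<^bsub>tensor_free V W\<^esub> u = {h + u | h. h \<in> tensor_rel S V W}"
  by (auto simp: r_coset_def)

lemma tensor_coset_eqI:
  assumes "u - v \<in> tensor_rel S V W"
  shows "tensor_rel S V W #>\<^bsub>tensor_free V W\<^esub> u = tensor_rel S V W #>\<^bsub>tensor_free V W\<^esub> v"
  unfolding tensor_coset_eq
proof (intro equalityI subsetI)
  fix z assume "z \<in> {h + u | h. h \<in> tensor_rel S V W}"
  then obtain h where "h \<in> tensor_rel S V W" "z = (h + (u - v)) + v" by auto
  with assms show "z \<in> {h + v | h. h \<in> tensor_rel S V W}" using add_in_tensor_rel by blast
next
  fix z assume "z \<in> {h + v | h. h \<in> tensor_rel S V W}"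
  then obtain h where "h \<in> tensor_rel S V W" "z = (h + - (u - v)) + u" by auto
  with assms show "z \<in> {h + u | h. h \<in> tensor_rel S V W}"
    using add_in_tensor_rel minus_in_tensor_rel by blast
qed

lemma group_tensor_product: "group (tensor_free V W Mod tensor_rel S V W)"
  by (intro normal.factorgroup_is_group
      comm_group.subgroup_imp_normal[OF abelian_free_Abelian_group] subgroup_tensor_rel)

lemma tensor_product_sel:
  "carrier (tensor_product S V W) = carrier (tensor_free V W Mod tensor_rel S V W)"
  "t \<oplus>\<^bsub>tensor_product S V W\<^esub> u = t \<otimes>\<^bsub>tensor_free V W Mod tensor_rel S V W\<^esub> u"
  by (simp_all add: tensor_product_def Let_def)

lemma tensor_add_closed:
  "\<lbrakk>t \<in> carrier (tensor_product S V W); u \<in> carrier (tensor_product S V W)\<rbrakk>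
    \<Longrightarrow> t \<oplus>\<^bsub>tensor_product S V W\<^esub> u \<in> carrier (tensor_product S V W)"
  unfolding tensor_product_sel
  by (rule monoid.m_closed[OF group.is_monoid[OF group_tensor_product]])

lemma tensor_coset_closed:
  "u \<in> carrier (tensor_free V W)
    \<Longrightarrow> tensor_rel S V W #>\<^bsub>tensor_free V W\<^esub> u \<in> carrier (tensor_product S V W)"
  unfolding tensor_product_sel by (auto simp: FactGroup_def RCOSETS_def)

lemma tensor_coset_add:
  assumes "u \<in> carrier (tensor_free V W)" "v \<in> carrier (tensor_free V W)"
  shows "(tensor_rel S V W #>\<^bsub>tensor_free V W\<^esub> u) \<oplus>\<^bsub>tensor_product S V W\<^esub>
      (tensor_rel S V W #>\<^bsub>tensor_free V W\<^esub> v) = tensor_rel S V W #>\<^bsub>tensor_free V W\<^esub> (u + v)"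
  using normal.rcos_sum[OF comm_group.subgroup_imp_normal[OF abelian_free_Abelian_group subgroup_tensor_rel] assms]
  by (simp add: tensor_product_sel FactGroup_def)

lemma pure_tensor_closed [simp]:
  "\<lbrakk>x \<in> carrier V; y \<in> carrier W\<rbrakk> \<Longrightarrow> pure_tensor S V W x y \<in> carrier (tensor_product S V W)"
  unfolding pure_tensor_def by (rule tensor_coset_closed) simp

lemma pure_tensor_add_left:
  assumes "x \<in> carrier V" "x' \<in> carrier V" "y \<in> carrier W"
  shows "pure_tensor S V W (x \<oplus>\<^bsub>V\<^esub> x') y =
    pure_tensor S V W x y \<oplus>\<^bsub>tensor_product S V W\<^esub> pure_tensor S V W x' y"
  unfolding pure_tensor_def using assms tensor_rel_add_left[OF assms(1,3,2)]
  by (subst tensor_coset_add) (simp_all add: diff_diff_eq tensor_coset_eqI)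

lemma pure_tensor_add_right:
  assumes "x \<in> carrier V" "y \<in> carrier W" "y' \<in> carrier W"
  shows "pure_tensor S V W x (y \<oplus>\<^bsub>W\<^esub> y') =
    pure_tensor S V W x y \<oplus>\<^bsub>tensor_product S V W\<^esub> pure_tensor S V W x y'"
  unfolding pure_tensor_def using assms tensor_rel_add_right[OF assms]
  by (subst tensor_coset_add) (simp_all add: diff_diff_eq tensor_coset_eqI)

lemma pure_tensor_balanced:
  assumes "x \<in> carrier V" "s \<in> carrier S" "y \<in> carrier W"
  shows "pure_tensor S V W (x \<odot>r\<^bsub>V\<^esub> s) y = pure_tensor S V W x (s \<odot>\<^bsub>W\<^esub> y)"
  unfolding pure_tensor_def by (rule tensor_coset_eqI[OF tensor_rel_balanced[OF assms(1,3,2)]])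

section \<open>The two actions on the tensor product\<close>

text \<open>The extension of \<open>f\<close> is additive. Once it maps relations to relations, the
  coset of \<open>u\<close> lands in the coset of \<open>frag_extend f u\<close>, and adding the
  relations fills that coset. This makes the actions independent of representatives.\<close>

lemma frag_extend_coset:
  assumes closed: "\<And>h. h \<in> tensor_rel S V W \<Longrightarrow> frag_extend f h \<in> tensor_rel S V W"
  shows "tensor_rel S V W <#>\<^bsub>tensor_free V W\<^esub>
      (frag_extend f ` (tensor_rel S V W #>\<^bsub>tensor_free V W\<^esub> u)) =
    tensor_rel S V W #>\<^bsub>tensor_free V W\<^esub> frag_extend f u"
  unfolding tensor_coset_eq
proof (intro equalityI subsetI)
  fix z
  assume "z \<in> tensor_rel S V W <#>\<^bsub>tensor_free V W\<^esub> frag_extend f ` {h + u | h. h \<in> tensor_rel S V W}"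
  then obtain h h' where "h \<in> tensor_rel S V W" "h' \<in> tensor_rel S V W"
      "z = (h + frag_extend f h') + frag_extend f u"
    by (auto simp: set_mult_def frag_extend_add add.assoc)
  then show "z \<in> {h + frag_extend f u | h. h \<in> tensor_rel S V W}"
    using closed add_in_tensor_rel by blast
next
  fix z assume "z \<in> {h + frag_extend f u | h. h \<in> tensor_rel S V W}"
  \<comment> \<open>The image of the single representative \<open>u = 0 + u\<close> already yields
    the whole coset.\<close>
  then obtain h where "h \<in> tensor_rel S V W" "z = h + frag_extend f (0 + u)" by auto
  then show "z \<in> tensor_rel S V W <#>\<^bsub>tensor_free V W\<^esub> frag_extend f ` {h + u | h. h \<in> tensor_rel S V W}"
    unfolding set_mult_def using zero_in_tensor_rel by fastforce
qed

text \<open>Additivity reduces the invariance of a generated subgroup to its generators, which here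
  form three families.\<close>

lemma frag_extend_tensor_rel:
  assumes u: "u \<in> tensor_rel S V W"
    and add_left: "\<And>x x' y. \<lbrakk>x \<in> carrier V; x' \<in> carrier V; y \<in> carrier W\<rbrakk>
      \<Longrightarrow> f (x \<oplus>\<^bsub>V\<^esub> x', y) - f (x, y) - f (x', y) \<in> tensor_rel S V W"
    and add_right: "\<And>x y y'. \<lbrakk>x \<in> carrier V; y \<in> carrier W; y' \<in> carrier W\<rbrakk>
      \<Longrightarrow> f (x, y \<oplus>\<^bsub>W\<^esub> y') - f (x, y) - f (x, y') \<in> tensor_rel S V W"
    and balanced: "\<And>x s y. \<lbrakk>x \<in> carrier V; s \<in> carrier S; y \<in> carrier W\<rbrakk>
      \<Longrightarrow> f (x \<odot>r\<^bsub>V\<^esub> s, y) - f (x, s \<odot>\<^bsub>W\<^esub> y) \<in> tensor_rel S V W"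
  shows "frag_extend f u \<in> tensor_rel S V W"
  using u unfolding tensor_rel_def[of S V W]
proof (induction rule: generate.induct)
  case one
  show ?case by (simp add: zero_in_tensor_rel flip: tensor_rel_def)
next
  case (incl h)
  then show ?case unfolding tensor_rel_def[symmetric]
    by (auto simp: frag_extend_diff intro: add_left add_right balanced)
next
  case (inv h)
  then have *: "frag_extend f h \<in> tensor_rel S V W"
    by (auto simp: frag_extend_diff intro: add_left add_right balanced)
  \<comment> \<open>Membership puts \<open>h\<close> into the carrier, where the group inverse is
    \<open>- h\<close>.\<close>
  have "h \<in> tensor_rel S V W"
    unfolding tensor_rel_def by (rule generate.incl[OF inv])
  then have "inv\<^bsub>tensor_free V W\<^esub> h = - h"
    using subgroup.subset[OF subgroup_tensor_rel] by (auto simp: subset_iff)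
  with * show ?case unfolding tensor_rel_def[symmetric]
    by (simp add: frag_extend_minus minus_in_tensor_rel)
next
  case (eng h h')
  then show ?case unfolding tensor_rel_def[symmetric]
    by (simp add: frag_extend_add add_in_tensor_rel)
qed

text \<open>The balancing relations survive left multiplication because the two actions on
  \<open>V\<close> commute: \<open>(a x) s = a (x s)\<close>.\<close>

lemma smult_pure_tensor:
  assumes "a \<in> carrier R" "x \<in> carrier V" "y \<in> carrier W"
  shows "a \<odot>\<^bsub>tensor_product S V W\<^esub> pure_tensor S V W x y = pure_tensor S V W (a \<odot>\<^bsub>V\<^esub> x) y"
proof -
  let ?f = "\<lambda>(x, y). frag_of (a \<odot>\<^bsub>V\<^esub> x, y)"
  have "frag_extend ?f u \<in> tensor_rel S V W" if "u \<in> tensor_rel S V W" for u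
  proof (rule frag_extend_tensor_rel[OF that])
    fix x x' y assume "x \<in> carrier V" "x' \<in> carrier V" "y \<in> carrier W"
    with assms(1) show "?f (x \<oplus>\<^bsub>V\<^esub> x', y) - ?f (x, y) - ?f (x', y) \<in> tensor_rel S V W"
      by (simp add: V.smult_r_distr tensor_rel_add_left)
  next
    fix x y y' assume "x \<in> carrier V" "y \<in> carrier W" "y' \<in> carrier W"
    with assms(1) show "?f (x, y \<oplus>\<^bsub>W\<^esub> y') - ?f (x, y) - ?f (x, y') \<in> tensor_rel S V W"
      by (simp add: tensor_rel_add_right)
  next
    fix x s y assume "x \<in> carrier V" "s \<in> carrier S" "y \<in> carrier W"
    with assms(1) show "?f (x \<odot>r\<^bsub>V\<^esub> s, y) - ?f (x, s \<odot>\<^bsub>W\<^esub> y) \<in> tensor_rel S V W"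
      by (simp add: tensor_rel_balanced flip: V.smult_rsmult)
  qed
  from frag_extend_coset[OF this, of "frag_of (x, y)"] show ?thesis
    by (simp add: tensor_product_def Let_def pure_tensor_def)
qed

text \<open>Mirror image of the left action; balancing now rests on \<open>(s y) p = s (y p)\<close>
  in \<open>W\<close>.\<close>

lemma pure_tensor_rsmult:
  assumes "p \<in> carrier P" "x \<in> carrier V" "y \<in> carrier W"
  shows "pure_tensor S V W x y \<odot>r\<^bsub>tensor_product S V W\<^esub> p = pure_tensor S V W x (y \<odot>r\<^bsub>W\<^esub> p)"
proof -
  let ?f = "\<lambda>(x, y). frag_of (x, y \<odot>r\<^bsub>W\<^esub> p)"
  have "frag_extend ?f u \<in> tensor_rel S V W" if "u \<in> tensor_rel S V W" for u
  proof (rule frag_extend_tensor_rel[OF that])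
    fix x x' y assume "x \<in> carrier V" "x' \<in> carrier V" "y \<in> carrier W"
    with assms(1) show "?f (x \<oplus>\<^bsub>V\<^esub> x', y) - ?f (x, y) - ?f (x', y) \<in> tensor_rel S V W"
      by (simp add: tensor_rel_add_left)
  next
    fix x y y' assume "x \<in> carrier V" "y \<in> carrier W" "y' \<in> carrier W"
    with assms(1) show "?f (x, y \<oplus>\<^bsub>W\<^esub> y') - ?f (x, y) - ?f (x, y') \<in> tensor_rel S V W"
      by (simp add: W.rsmult_l_distr tensor_rel_add_right)
  next
    fix x s y assume "x \<in> carrier V" "s \<in> carrier S" "y \<in> carrier W"
    with assms(1) show "?f (x \<odot>r\<^bsub>V\<^esub> s, y) - ?f (x, s \<odot>\<^bsub>W\<^esub> y) \<in> tensor_rel S V W"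
      by (simp add: W.smult_rsmult tensor_rel_balanced)
  qed
  from frag_extend_coset[OF this, of "frag_of (x, y)"] show ?thesis
    by (simp add: tensor_product_def Let_def pure_tensor_def)
qed

end

section \<open>Commuting nilpotent perturbations in positive characteristic\<close>

text \<open>The binomial expansion modulo \<open>w \<otimes> w\<close>, by induction on the
  exponent. The commutation of \<open>u\<close> with \<open>x\<close> and \<open>w\<close> is
  recorded so that the expansion can be iterated with \<open>w \<otimes> w \<otimes> u\<close> in
  place of \<open>w\<close>. Writing the exponent as \<open>Suc j\<close> keeps predecessors out of
  the linear term.\<close>

lemma (in ring) pow_add_commuting:
  assumes carr: "x \<in> carrier R" "w \<in> carrier R" and comm: "x \<otimes> w = w \<otimes> x"
  shows "\<exists>u \<in> carrier R. u \<otimes> x = x \<otimes> u \<and> u \<otimes> w = w \<otimes> u \<and>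
    (x \<oplus> w) [^] Suc j = x [^] Suc j \<oplus> add_pow R (Suc j) (x [^] j) \<otimes> w \<oplus> w \<otimes> w \<otimes> u"
proof (induction j)
  case 0
  show ?case using carr by (intro bexI[of _ \<zero>]) auto
next
  case (Suc j)
  then obtain u where u: "u \<in> carrier R" "u \<otimes> x = x \<otimes> u" "u \<otimes> w = w \<otimes> u"
    and eq: "(x \<oplus> w) [^] Suc j = x [^] Suc j \<oplus> add_pow R (Suc j) (x [^] j) \<otimes> w \<oplus> w \<otimes> w \<otimes> u" by blast
  define p where "p = add_pow R (Suc j) (x [^] j)"
  have p: "p \<in> carrier R" unfolding p_def using carr by auto
  have px: "p \<otimes> x = add_pow R (Suc j) (x [^] Suc j)" "x \<otimes> p = add_pow R (Suc j) (x [^] Suc j)"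
    unfolding p_def using carr by (simp_all add: add_pow_ldistr add_pow_rdistr nat_pow_Suc2[symmetric] del: add.nat_pow_Suc nat_pow_Suc)
  have pw: "p \<otimes> w = w \<otimes> p"
    unfolding p_def using carr comm
    by (simp add: add_pow_ldistr add_pow_rdistr group_commutes_pow del: add.nat_pow_Suc)
  \<comment> \<open>A further factor \<open>x \<oplus> w\<close> leaves two multiples of
    \<open>w \<otimes> w\<close>: one from the linear term times \<open>w\<close>, one from the old
    remainder. Their cofactors \<open>p\<close> and \<open>u \<otimes> (x \<oplus> w)\<close> add up
    to \<open>v\<close>.\<close>
  define v where "v = p \<oplus> u \<otimes> (x \<oplus> w)"
  have v: "v \<in> carrier R" "v \<otimes> x = x \<otimes> v" "v \<otimes> w = w \<otimes> v"
  proof -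
    show "v \<in> carrier R" unfolding v_def using p u carr by simp
    have "u \<otimes> x \<otimes> x = x \<otimes> (u \<otimes> x)" "u \<otimes> w \<otimes> x = x \<otimes> (u \<otimes> w)"
      "u \<otimes> x \<otimes> w = w \<otimes> (u \<otimes> x)" "u \<otimes> w \<otimes> w = w \<otimes> (u \<otimes> w)"
      using u carr comm by (metis m_assoc)+
    then show "v \<otimes> x = x \<otimes> v" "v \<otimes> w = w \<otimes> v"
      unfolding v_def using p u carr px pw by (simp_all add: l_distr r_distr del: add.nat_pow_Suc nat_pow_Suc)
  qed
  have "(x \<oplus> w) [^] Suc (Suc j) = (x [^] Suc j \<oplus> p \<otimes> w \<oplus> w \<otimes> w \<otimes> u) \<otimes> (x \<oplus> w)"
    using eq by (simp add: p_def)
  also have "\<dots> = x [^] Suc j \<otimes> x \<oplus> (x [^] Suc j \<otimes> w \<oplus> p \<otimes> w \<otimes> x) \<oplus> (p \<otimes> w \<otimes> w \<oplus> w \<otimes> w \<otimes> (u \<otimes> (x \<oplus> w)))"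
    using carr p u by (simp add: l_distr r_distr m_assoc a_ac del: nat_pow_Suc)
  \<comment> \<open>The two terms linear in \<open>w\<close> are merged: one copy and
    \<open>Suc j\<close> copies of \<open>x [^] Suc j \<otimes> w\<close> give
    \<open>Suc (Suc j)\<close> copies.\<close>
  also have "p \<otimes> w \<otimes> x = p \<otimes> x \<otimes> w" using carr p comm by (simp add: m_assoc)
  also have "x [^] Suc j \<otimes> w \<oplus> p \<otimes> x \<otimes> w = add_pow R (Suc (Suc j)) (x [^] Suc j) \<otimes> w"
    using carr p by (simp add: px l_distr[symmetric] a_comm del: nat_pow_Suc)
  also have "p \<otimes> w \<otimes> w = w \<otimes> w \<otimes> p" using carr p pw by (metis m_assoc)
  also have "w \<otimes> w \<otimes> p \<oplus> w \<otimes> w \<otimes> (u \<otimes> (x \<oplus> w)) = w \<otimes> w \<otimes> v"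
    unfolding v_def using carr p u by (simp add: r_distr)
  finally show ?case using v by auto
qed

text \<open>The \<open>c\<close>-th power kills the linear term and so turns the pair
  \<open>x\<close>, \<open>w\<close> into \<open>x [^] c\<close>,
  \<open>w \<otimes> w \<otimes> u\<close>. The new perturbation dies at half the exponent, hence
  \<open>i\<close> rounds remove it. The number \<open>c\<close> may be composite, as only the
  linear coefficient has to vanish.\<close>

lemma (in ring) pow_char_eq:
  fixes c :: nat
  assumes c: "0 < c" "add_pow R c \<one> = \<zero>"
    and "x \<in> carrier R" "w \<in> carrier R" "x \<otimes> w = w \<otimes> x" "w [^] (2 ^ i :: nat) = \<zero>"
  shows "(x \<oplus> w) [^] (c ^ i) = x [^] (c ^ i)"
  using assms(3-)
proof (induction i arbitrary: x w)
  case 0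
  then show ?case by simp
next
  case (Suc i)
  note x = \<open>x \<in> carrier R\<close> and w = \<open>w \<in> carrier R\<close>
  obtain j where j: "c = Suc j" using c(1) gr0_conv_Suc by blast
  obtain u where u: "u \<in> carrier R" "u \<otimes> x = x \<otimes> u" "u \<otimes> w = w \<otimes> u"
    and eq: "(x \<oplus> w) [^] c = x [^] c \<oplus> add_pow R c (x [^] j) \<otimes> w \<oplus> w \<otimes> w \<otimes> u"
    using pow_add_commuting[OF Suc.prems(1-3), of j] j by blast
  have "add_pow R c (x [^] j) = add_pow R c \<one> \<otimes> x [^] j" using x by (simp add: add_pow_ldistr)
  then have "add_pow R c (x [^] j) = \<zero>" using c(2) x by simp
  then have eq': "(x \<oplus> w) [^] c = x [^] c \<oplus> w \<otimes> w \<otimes> u" using eq x w u by simp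
  have comm_c: "x [^] c \<otimes> z = z \<otimes> x [^] c" if "x \<otimes> z = z \<otimes> x" "z \<in> carrier R" for z
    using group_commutes_pow[of x z c] that x by simp
  have "x [^] c \<otimes> (w \<otimes> w \<otimes> u) = w \<otimes> w \<otimes> u \<otimes> x [^] c"
    using comm_c[OF Suc.prems(3) w] comm_c[OF u(2)[symmetric] u(1)] x w u(1) by (metis m_assoc m_closed nat_pow_closed)
  \<comment> \<open>As \<open>u\<close> commutes with \<open>w \<otimes> w\<close>, the power
    splits, and its first factor is \<open>w [^] (2 ^ Suc i)\<close>.\<close>
  moreover have "(w \<otimes> w \<otimes> u) [^] (2 ^ i :: nat) = \<zero>"
  proof -
    have "w \<otimes> w \<otimes> u = u \<otimes> (w \<otimes> w)" using w u by (metis m_assoc)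
    moreover have "w [^] (2::nat) = w \<otimes> w" using w by (simp add: numeral_2_eq_2)
    ultimately have "(w \<otimes> w \<otimes> u) [^] (2 ^ i :: nat) = (w [^] (2::nat)) [^] (2 ^ i :: nat) \<otimes> u [^] (2 ^ i :: nat)"
      using pow_mult_distrib[of "w \<otimes> w" u "2 ^ i"] w u by simp
    also have "(w [^] (2::nat)) [^] (2 ^ i :: nat) = \<zero>"
      using Suc.prems(4) w by (simp add: nat_pow_pow)
    finally show ?thesis using u by simp
  qed
  ultimately have "(x [^] c \<oplus> w \<otimes> w \<otimes> u) [^] (c ^ i) = (x [^] c) [^] (c ^ i)"
    using x w u by (intro Suc.IH) simp_all
  then have "((x \<oplus> w) [^] c) [^] (c ^ i) = (x [^] c) [^] (c ^ i)" by (simp add: eq')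
  then show ?case using x w by (simp add: nat_pow_pow)
qed

section \<open>Eventual periods and positive characteristic\<close>

lemma (in monoid) pow_eventually_periodic:
  fixes n :: nat
  assumes "a \<in> carrier G" "a [^] n = a [^] (n + e)" "n \<le> r"
  shows "a [^] (r + q * e) = a [^] r"
proof (induction q)
  case (Suc q)
  have "r + Suc q * e = (n + e) + (r - n + q * e)" "r + q * e = n + (r - n + q * e)"
    using assms(3) by simp_all
  then show ?case using assms(1,2) Suc by (metis nat_pow_mult)
qed simp

text \<open>The period is the difference of two exponents with equal powers, and the preperiod is
  the smaller one. Allowing all multiples of \<open>e\<close> lets the periods of two elements be
  combined into their product.\<close>

lemma (in periodic_ring) eventual_period:
  assumes "a \<in> carrier R"
  shows "\<exists>n e :: nat. 0 < e \<and> (\<forall>r \<ge> n. \<forall>q. a [^] (r + q * e) = a [^] r)"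
proof -
  obtain m n :: nat where mn: "m \<noteq> n" "a [^] m = a [^] n" using periodic[OF assms] by blast
  have "min m n + (max m n - min m n) = max m n" by simp
  then have "a [^] min m n = a [^] (min m n + (max m n - min m n))"
    using mn by (metis max_def min_def)
  moreover have "0 < max m n - min m n" using mn(1) by auto
  ultimately show ?thesis
    using monoid.pow_eventually_periodic[OF monoid_axioms assms] by blast
qed

lemma (in ring) of_nat_pow:
  fixes k m :: nat
  shows "(add_pow R k \<one>) [^] m = add_pow R (k ^ m :: nat) \<one>"
  by (induction m) (simp_all add: add_pow_ldistr add_pow_rdistr add.nat_pow_pow mult.commute)

lemma (in periodic_ring) finite_characteristic:
  obtains c :: nat where "0 < c" "add_pow R c \<one> = \<zero>"
proof -
  \<comment> \<open>The witness is \<open>2 ^ n - 2 ^ m\<close>. The order \<open>m < n\<close>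
    keeps the natural subtraction positive; the claim is used later for both orders of the
    exponents.\<close>
  have *: "\<exists>c>0. add_pow R (c :: nat) \<one> = \<zero>" if "m < n" "add_pow R (2 ^ m :: nat) \<one> = add_pow R (2 ^ n :: nat) \<one>" for m n :: nat
  proof (intro exI conjI)
    have less: "(2::nat) ^ m < 2 ^ n" using \<open>m < n\<close> by simp
    then show "0 < (2::nat) ^ n - 2 ^ m" by simp
    have "add_pow R (2 ^ n - 2 ^ m :: nat) \<one> \<oplus> add_pow R (2 ^ m :: nat) \<one> = add_pow R (2 ^ n :: nat) \<one>"
      using less by (subst add.nat_pow_mult) simp_all
    then show "add_pow R (2 ^ n - 2 ^ m :: nat) \<one> = \<zero>"
      using that(2) by (metis add.nat_pow_closed add.r_cancel_one' one_closed)
  qed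
  \<comment> \<open>Periodicity is applied to \<open>1 + 1\<close>, whose powers are the multiples
    of the identity by powers of 2.\<close>
  obtain m n :: nat where "m \<noteq> n" "(add_pow R (2 :: nat) \<one>) [^] m = (add_pow R (2 :: nat) \<one>) [^] n"
    using periodic[of "add_pow R (2 :: nat) \<one>"] by auto
  then show thesis
    using *[of m n] *[of n m] that unfolding of_nat_pow by (metis linorder_neqE_nat)
qed

section \<open>The ring of a pair of bimodule pairings\<close>

text \<open>Balanced bilinear pairings stand in for the homomorphisms out of the tensor products.
  The axioms are symmetric, so each fact about \<open>A\<close> and \<open>N\<close> yields its
  counterpart for \<open>B\<close> and \<open>M\<close> through \<open>swap\<close>.\<close>

locale morita_pairing =
  A: ring A + B: ring B + M: bimodule B A M + N: bimodule A B N
  for A :: "('a, 'r) ring_scheme" and B :: "('b, 's) ring_scheme"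
    and M :: "('b, 'a, 'm, 'x) bimodule_scheme" and N :: "('a, 'b, 'n, 'y) bimodule_scheme" +
  fixes p :: "'n \<Rightarrow> 'm \<Rightarrow> 'a" and q :: "'m \<Rightarrow> 'n \<Rightarrow> 'b"
  assumes p_closed [simp, intro]: "\<lbrakk>n \<in> carrier N; m \<in> carrier M\<rbrakk> \<Longrightarrow> p n m \<in> carrier A"
    and q_closed [simp, intro]: "\<lbrakk>m \<in> carrier M; n \<in> carrier N\<rbrakk> \<Longrightarrow> q m n \<in> carrier B"
    and p_add_left: "\<lbrakk>n \<in> carrier N; n' \<in> carrier N; m \<in> carrier M\<rbrakk>
      \<Longrightarrow> p (n \<oplus>\<^bsub>N\<^esub> n') m = p n m \<oplus>\<^bsub>A\<^esub> p n' m"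
    and p_add_right: "\<lbrakk>n \<in> carrier N; m \<in> carrier M; m' \<in> carrier M\<rbrakk>
      \<Longrightarrow> p n (m \<oplus>\<^bsub>M\<^esub> m') = p n m \<oplus>\<^bsub>A\<^esub> p n m'"
    and q_add_left: "\<lbrakk>m \<in> carrier M; m' \<in> carrier M; n \<in> carrier N\<rbrakk>
      \<Longrightarrow> q (m \<oplus>\<^bsub>M\<^esub> m') n = q m n \<oplus>\<^bsub>B\<^esub> q m' n"
    and q_add_right: "\<lbrakk>m \<in> carrier M; n \<in> carrier N; n' \<in> carrier N\<rbrakk>
      \<Longrightarrow> q m (n \<oplus>\<^bsub>N\<^esub> n') = q m n \<oplus>\<^bsub>B\<^esub> q m n'"
    and p_balanced: "\<lbrakk>n \<in> carrier N; b \<in> carrier B; m \<in> carrier M\<rbrakk>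
      \<Longrightarrow> p (n \<odot>r\<^bsub>N\<^esub> b) m = p n (b \<odot>\<^bsub>M\<^esub> m)"
    and q_balanced: "\<lbrakk>m \<in> carrier M; a \<in> carrier A; n \<in> carrier N\<rbrakk>
      \<Longrightarrow> q (m \<odot>r\<^bsub>M\<^esub> a) n = q m (a \<odot>\<^bsub>N\<^esub> n)"
    and p_smult: "\<lbrakk>a \<in> carrier A; n \<in> carrier N; m \<in> carrier M\<rbrakk> \<Longrightarrow> p (a \<odot>\<^bsub>N\<^esub> n) m = a \<otimes>\<^bsub>A\<^esub> p n m"
    and q_smult: "\<lbrakk>b \<in> carrier B; m \<in> carrier M; n \<in> carrier N\<rbrakk> \<Longrightarrow> q (b \<odot>\<^bsub>M\<^esub> m) n = b \<otimes>\<^bsub>B\<^esub> q m n"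
    and p_rsmult: "\<lbrakk>n \<in> carrier N; m \<in> carrier M; a \<in> carrier A\<rbrakk> \<Longrightarrow> p n (m \<odot>r\<^bsub>M\<^esub> a) = p n m \<otimes>\<^bsub>A\<^esub> a"
    and q_rsmult: "\<lbrakk>m \<in> carrier M; n \<in> carrier N; b \<in> carrier B\<rbrakk> \<Longrightarrow> q m (n \<odot>r\<^bsub>N\<^esub> b) = q m n \<otimes>\<^bsub>B\<^esub> b"
    and p_q: "\<lbrakk>m \<in> carrier M; n \<in> carrier N; n' \<in> carrier N\<rbrakk> \<Longrightarrow> p n m \<odot>\<^bsub>N\<^esub> n' = n \<odot>r\<^bsub>N\<^esub> q m n'"
    and q_p: "\<lbrakk>m \<in> carrier M; n \<in> carrier N; m' \<in> carrier M\<rbrakk> \<Longrightarrow> q m n \<odot>\<^bsub>M\<^esub> m' = m \<odot>r\<^bsub>M\<^esub> p n m'"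
begin

lemma swap: "morita_pairing B A N M q p"
  by unfold_locales
    (auto simp: p_add_left p_add_right q_add_left q_add_right p_balanced q_balanced
      p_smult q_smult p_rsmult q_rsmult p_q q_p)

lemma p_zero:
  shows p_zero_left [simp]: "m \<in> carrier M \<Longrightarrow> p \<zero>\<^bsub>N\<^esub> m = \<zero>\<^bsub>A\<^esub>"
    and p_zero_right [simp]: "n \<in> carrier N \<Longrightarrow> p n \<zero>\<^bsub>M\<^esub> = \<zero>\<^bsub>A\<^esub>"
  using p_add_left[of "\<zero>\<^bsub>N\<^esub>" "\<zero>\<^bsub>N\<^esub>" m] p_add_right[of n "\<zero>\<^bsub>M\<^esub>" "\<zero>\<^bsub>M\<^esub>"] by simp_all

lemma q_zero:
  shows q_zero_left [simp]: "n \<in> carrier N \<Longrightarrow> q \<zero>\<^bsub>M\<^esub> n = \<zero>\<^bsub>B\<^esub>"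
    and q_zero_right [simp]: "m \<in> carrier M \<Longrightarrow> q m \<zero>\<^bsub>N\<^esub> = \<zero>\<^bsub>B\<^esub>"
  using morita_pairing.p_zero[OF swap] by simp_all

lemma smult_zero:
  shows N_smult_l_null [simp]: "n \<in> carrier N \<Longrightarrow> \<zero>\<^bsub>A\<^esub> \<odot>\<^bsub>N\<^esub> n = \<zero>\<^bsub>N\<^esub>"
    and N_smult_r_null [simp]: "a \<in> carrier A \<Longrightarrow> a \<odot>\<^bsub>N\<^esub> \<zero>\<^bsub>N\<^esub> = \<zero>\<^bsub>N\<^esub>"
    and N_rsmult_l_null [simp]: "b \<in> carrier B \<Longrightarrow> \<zero>\<^bsub>N\<^esub> \<odot>r\<^bsub>N\<^esub> b = \<zero>\<^bsub>N\<^esub>"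
    and N_rsmult_r_null [simp]: "n \<in> carrier N \<Longrightarrow> n \<odot>r\<^bsub>N\<^esub> \<zero>\<^bsub>B\<^esub> = \<zero>\<^bsub>N\<^esub>"
  using N.smult_l_distr[of "\<zero>\<^bsub>A\<^esub>" "\<zero>\<^bsub>A\<^esub>" n] N.smult_r_distr[of a "\<zero>\<^bsub>N\<^esub>" "\<zero>\<^bsub>N\<^esub>"]
    N.rsmult_l_distr[of "\<zero>\<^bsub>N\<^esub>" "\<zero>\<^bsub>N\<^esub>" b] N.rsmult_r_distr[of n "\<zero>\<^bsub>B\<^esub>" "\<zero>\<^bsub>B\<^esub>"] by simp_all

lemma
  shows M_smult_l_null [simp]: "m \<in> carrier M \<Longrightarrow> \<zero>\<^bsub>B\<^esub> \<odot>\<^bsub>M\<^esub> m = \<zero>\<^bsub>M\<^esub>"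
    and M_smult_r_null [simp]: "b \<in> carrier B \<Longrightarrow> b \<odot>\<^bsub>M\<^esub> \<zero>\<^bsub>M\<^esub> = \<zero>\<^bsub>M\<^esub>"
    and M_rsmult_l_null [simp]: "a \<in> carrier A \<Longrightarrow> \<zero>\<^bsub>M\<^esub> \<odot>r\<^bsub>M\<^esub> a = \<zero>\<^bsub>M\<^esub>"
    and M_rsmult_r_null [simp]: "m \<in> carrier M \<Longrightarrow> m \<odot>r\<^bsub>M\<^esub> \<zero>\<^bsub>A\<^esub> = \<zero>\<^bsub>M\<^esub>"
  using morita_pairing.smult_zero[OF swap] by simp_all

text \<open>This is \<open>morita_ring\<close> with its two maps on pure tensors abstracted to
  \<open>p\<close> and \<open>q\<close>, so that the two coincide by definition once the pairings
  are instantiated.\<close>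

definition T :: "('a \<times> 'n \<times> 'm \<times> 'b) ring" where
  "T = \<lparr> carrier = carrier A \<times> carrier N \<times> carrier M \<times> carrier B,
      monoid.mult = (\<lambda>(a1, n1, m1, b1) (a2, n2, m2, b2).
        (a1 \<otimes>\<^bsub>A\<^esub> a2 \<oplus>\<^bsub>A\<^esub> p n1 m2,
         (a1 \<odot>\<^bsub>N\<^esub> n2) \<oplus>\<^bsub>N\<^esub> (n1 \<odot>r\<^bsub>N\<^esub> b2),
         (m1 \<odot>r\<^bsub>M\<^esub> a2) \<oplus>\<^bsub>M\<^esub> (b1 \<odot>\<^bsub>M\<^esub> m2),
         q m1 n2 \<oplus>\<^bsub>B\<^esub> b1 \<otimes>\<^bsub>B\<^esub> b2)),
      one = (\<one>\<^bsub>A\<^esub>, \<zero>\<^bsub>N\<^esub>, \<zero>\<^bsub>M\<^esub>, \<one>\<^bsub>B\<^esub>),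
      ring.zero = (\<zero>\<^bsub>A\<^esub>, \<zero>\<^bsub>N\<^esub>, \<zero>\<^bsub>M\<^esub>, \<zero>\<^bsub>B\<^esub>),
      add = (\<lambda>(a1, n1, m1, b1) (a2, n2, m2, b2).
        (a1 \<oplus>\<^bsub>A\<^esub> a2, n1 \<oplus>\<^bsub>N\<^esub> n2, m1 \<oplus>\<^bsub>M\<^esub> m2, b1 \<oplus>\<^bsub>B\<^esub> b2)) \<rparr>"

lemma T_carrier [simp]:
  "(a, n, m, b) \<in> carrier T \<longleftrightarrow> a \<in> carrier A \<and> n \<in> carrier N \<and> m \<in> carrier M \<and> b \<in> carrier B"
  by (simp add: T_def)

lemma T_simps [simp]:
  "(a1, n1, m1, b1) \<otimes>\<^bsub>T\<^esub> (a2, n2, m2, b2) =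
    (a1 \<otimes>\<^bsub>A\<^esub> a2 \<oplus>\<^bsub>A\<^esub> p n1 m2, (a1 \<odot>\<^bsub>N\<^esub> n2) \<oplus>\<^bsub>N\<^esub> (n1 \<odot>r\<^bsub>N\<^esub> b2),
     (m1 \<odot>r\<^bsub>M\<^esub> a2) \<oplus>\<^bsub>M\<^esub> (b1 \<odot>\<^bsub>M\<^esub> m2), q m1 n2 \<oplus>\<^bsub>B\<^esub> b1 \<otimes>\<^bsub>B\<^esub> b2)"
  "(a1, n1, m1, b1) \<oplus>\<^bsub>T\<^esub> (a2, n2, m2, b2) = (a1 \<oplus>\<^bsub>A\<^esub> a2, n1 \<oplus>\<^bsub>N\<^esub> n2, m1 \<oplus>\<^bsub>M\<^esub> m2, b1 \<oplus>\<^bsub>B\<^esub> b2)"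
  "\<one>\<^bsub>T\<^esub> = (\<one>\<^bsub>A\<^esub>, \<zero>\<^bsub>N\<^esub>, \<zero>\<^bsub>M\<^esub>, \<one>\<^bsub>B\<^esub>)"
  "\<zero>\<^bsub>T\<^esub> = (\<zero>\<^bsub>A\<^esub>, \<zero>\<^bsub>N\<^esub>, \<zero>\<^bsub>M\<^esub>, \<zero>\<^bsub>B\<^esub>)"
  by (simp_all add: T_def)

text \<open>The diagonal entries agree by additivity, linearity and balancedness of the pairings. In
  the off-diagonal entries, \<open>p_q\<close> and \<open>q_p\<close> match products such as
  \<open>p n1 m2\<close> acting on \<open>n3\<close> with \<open>n1\<close> acted on by
  \<open>q m2 n3\<close>.\<close>

lemma T_mult_assoc:
  assumes "x \<in> carrier T" "y \<in> carrier T" "z \<in> carrier T"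
  shows "(x \<otimes>\<^bsub>T\<^esub> y) \<otimes>\<^bsub>T\<^esub> z = x \<otimes>\<^bsub>T\<^esub> (y \<otimes>\<^bsub>T\<^esub> z)"
proof -
  obtain a1 n1 m1 b1 where x: "x = (a1, n1, m1, b1)" by (cases x)
  obtain a2 n2 m2 b2 where y: "y = (a2, n2, m2, b2)" by (cases y)
  obtain a3 n3 m3 b3 where z: "z = (a3, n3, m3, b3)" by (cases z)
  show ?thesis
    using assms unfolding x y z
    by (simp add: A.l_distr A.r_distr B.l_distr B.r_distr
        p_add_left p_add_right q_add_left q_add_right p_balanced q_balanced
        p_smult q_smult p_rsmult q_rsmult flip: p_q q_p)
      (simp add: M.smult_l_distr N.smult_l_distr M.smult_r_distr N.smult_r_distr
        M.rsmult_l_distr N.rsmult_l_distr M.rsmult_r_distr N.rsmult_r_distr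
        M.smult_assoc N.smult_assoc M.rsmult_assoc N.rsmult_assoc M.smult_rsmult N.smult_rsmult p_q q_p
        A.m_assoc B.m_assoc A.a_ac B.a_ac M.a_ac N.a_ac)
qed

lemma ring_T: "ring T"
proof (rule ringI)
  show "abelian_group T"
  proof (rule abelian_groupI)
    fix x assume "x \<in> carrier T"
    then obtain a n m b where x: "x = (a, n, m, b)" "a \<in> carrier A" "n \<in> carrier N" "m \<in> carrier M" "b \<in> carrier B"
      by (cases x) auto
    then show "\<exists>y \<in> carrier T. y \<oplus>\<^bsub>T\<^esub> x = \<zero>\<^bsub>T\<^esub>"
      by (intro bexI[of _ "(\<ominus>\<^bsub>A\<^esub> a, \<ominus>\<^bsub>N\<^esub> n, \<ominus>\<^bsub>M\<^esub> m, \<ominus>\<^bsub>B\<^esub> b)"]) (auto simp: A.l_neg B.l_neg M.l_neg N.l_neg)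
  next
    fix x y z assume "x \<in> carrier T" "y \<in> carrier T" "z \<in> carrier T"
    then show "(x \<oplus>\<^bsub>T\<^esub> y) \<oplus>\<^bsub>T\<^esub> z = x \<oplus>\<^bsub>T\<^esub> (y \<oplus>\<^bsub>T\<^esub> z)"
      by (cases x; cases y; cases z) (simp add: A.a_assoc B.a_assoc M.a_assoc N.a_assoc)
  next
    fix x y assume "x \<in> carrier T" "y \<in> carrier T"
    then show "x \<oplus>\<^bsub>T\<^esub> y = y \<oplus>\<^bsub>T\<^esub> x"
      by (cases x; cases y) (simp add: A.a_comm B.a_comm M.a_comm N.a_comm)
  qed (auto simp: split_paired_all)
  show "monoid T"
    by (rule monoidI) (auto simp: T_mult_assoc split_paired_all)
qed (auto simp: split_paired_all A.l_distr A.r_distr B.l_distr B.r_distr p_add_left p_add_right q_add_left q_add_right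
    M.smult_l_distr N.smult_l_distr M.smult_r_distr N.smult_r_distr
    M.rsmult_l_distr N.rsmult_l_distr M.rsmult_r_distr N.rsmult_r_distr
    A.a_ac B.a_ac M.a_ac N.a_ac)

end

section \<open>Nilpotency and periodicity\<close>

lemma ideal_power_mono: "I \<subseteq> J \<Longrightarrow> ideal_power R I k \<subseteq> ideal_power R J k"
proof (induction k)
  case (Suc k)
  show ?case
  proof
    fix x assume "x \<in> ideal_power R I (Suc k)"
    then show "x \<in> ideal_power R J (Suc k)"
      unfolding ideal_power.simps using Suc
      by (induction rule: ideal_prod.induct) (auto intro: ideal_prod.intros)
  qed
qed simp

lemma (in ring) ideal_power_subset_carrier:
  assumes "I \<subseteq> carrier R"
  shows "ideal_power R I k \<subseteq> carrier R"
proof (induction k)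
  case (Suc k)
  show ?case
  proof
    fix x assume "x \<in> ideal_power R I (Suc k)"
    then show "x \<in> carrier R"
      unfolding ideal_power.simps using Suc assms by (induction rule: ideal_prod.induct) auto
  qed
qed simp

text \<open>Here \<open>I\<close> is just a subset. The chain starts because the power of index 0 is
  the whole ring, and it continues because the product is monotone in its left factor.\<close>

lemma (in ring) ideal_power_Suc_subset:
  assumes "I \<subseteq> carrier R"
  shows "ideal_power R I (Suc k) \<subseteq> ideal_power R I k"
proof (induction k)
  case 0
  show ?case using ideal_power_subset_carrier[OF assms, of "Suc 0"] by simp
next
  case (Suc k)
  show ?case
  proof
    fix x assume "x \<in> ideal_power R I (Suc (Suc k))"
    then have "x \<in> ideal_prod R (ideal_power R I (Suc k)) I" by simp
    then have "x \<in> ideal_prod R (ideal_power R I k) I"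
      using Suc by (induction rule: ideal_prod.induct) (auto intro: ideal_prod.intros)
    then show "x \<in> ideal_power R I (Suc k)" by simp
  qed
qed

lemma (in ring) ideal_power_antimono:
  assumes "I \<subseteq> carrier R" "j \<le> k"
  shows "ideal_power R I k \<subseteq> ideal_power R I j"
  using lift_Suc_antimono_le[of "ideal_power R I"] ideal_power_Suc_subset[OF assms(1)] assms(2) by blast

lemma (in ring) ideal_power_add:
  "\<lbrakk>x \<in> ideal_power R I k; y \<in> ideal_power R I k\<rbrakk> \<Longrightarrow> x \<oplus> y \<in> ideal_power R I k"
  by (cases k) (auto intro: ideal_prod.sum)

lemma (in abelian_group) add_minus_cancel: "\<lbrakk>x \<in> carrier G; y \<in> carrier G\<rbrakk> \<Longrightarrow> x \<oplus> (y \<ominus> x) = y"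
  by (metis a_comm a_minus_def minus_closed add.inv_closed a_assoc l_neg r_zero)

section \<open>Additive spans of the pairing values\<close>

text \<open>These are the nonempty finite sums of values. For the pairings below, zero is a value at
  zero arguments, and negatives come from absorbing multiplication by minus one.\<close>

inductive_set pairing_span :: "('a, 'r) ring_scheme \<Rightarrow> 'n set \<Rightarrow> 'm set \<Rightarrow> ('n \<Rightarrow> 'm \<Rightarrow> 'a) \<Rightarrow> 'a set"
  for R and X and Y and f where
    val: "\<lbrakk>x \<in> X; y \<in> Y\<rbrakk> \<Longrightarrow> f x y \<in> pairing_span R X Y f"
  | sum: "\<lbrakk>s \<in> pairing_span R X Y f; t \<in> pairing_span R X Y f\<rbrakk> \<Longrightarrow> s \<oplus>\<^bsub>R\<^esub> t \<in> pairing_span R X Y f"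

context morita_pairing
begin

abbreviation I where "I \<equiv> pairing_span A (carrier N) (carrier M) p"
abbreviation J where "J \<equiv> pairing_span B (carrier M) (carrier N) q"

lemma I_subset: "I \<subseteq> carrier A"
proof
  fix g assume "g \<in> I"
  then show "g \<in> carrier A" by induction auto
qed

lemma I_carrier [simp, intro]: "g \<in> I \<Longrightarrow> g \<in> carrier A"
  using I_subset by blast

lemma I_smult: "\<lbrakk>g \<in> I; a \<in> carrier A\<rbrakk> \<Longrightarrow> a \<otimes>\<^bsub>A\<^esub> g \<in> I"
proof (induction rule: pairing_span.induct)
  case (val n m)
  then show ?case by (simp add: p_smult[symmetric] pairing_span.val)
next
  case (sum g h)
  then show ?case by (simp add: A.r_distr pairing_span.sum)
qed

lemma I_rsmult: "\<lbrakk>g \<in> I; a \<in> carrier A\<rbrakk> \<Longrightarrow> g \<otimes>\<^bsub>A\<^esub> a \<in> I"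
proof (induction rule: pairing_span.induct)
  case (val n m)
  then show ?case by (simp add: p_rsmult[symmetric] pairing_span.val)
next
  case (sum g h)
  then show ?case by (simp add: A.l_distr pairing_span.sum)
qed

lemma I_zero: "\<zero>\<^bsub>A\<^esub> \<in> I"
  using pairing_span.val[of "\<zero>\<^bsub>N\<^esub>" "carrier N" "\<zero>\<^bsub>M\<^esub>" "carrier M" p A] by simp

lemma I_minus: "\<lbrakk>g \<in> I; h \<in> I\<rbrakk> \<Longrightarrow> g \<ominus>\<^bsub>A\<^esub> h \<in> I"
  using I_smult[of h "\<ominus>\<^bsub>A\<^esub> \<one>\<^bsub>A\<^esub>"] by (simp add: a_minus_def A.l_minus pairing_span.sum)

lemma I_power_carrier: "x \<in> ideal_power A I k \<Longrightarrow> x \<in> carrier A"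
  using A.ideal_power_subset_carrier[OF I_subset] by blast

lemma I_power_mono: "\<lbrakk>x \<in> ideal_power A I k; j \<le> k\<rbrakk> \<Longrightarrow> x \<in> ideal_power A I j"
  using A.ideal_power_antimono[OF I_subset] by blast

lemma I_power_mult: "\<lbrakk>x \<in> ideal_power A I k; g \<in> I\<rbrakk> \<Longrightarrow> x \<otimes>\<^bsub>A\<^esub> g \<in> ideal_power A I (Suc k)"
  by (simp add: ideal_prod.prod)

section \<open>The filtration and nilpotency\<close>

text \<open>A factor from \<open>J\<close> acting on \<open>N\<close> becomes a factor from
  \<open>I\<close> in the pairing: moving \<open>q m' n'\<close> across by \<open>p_q\<close> turns
  the value into \<open>p n m' \<otimes> p n' m\<close>.\<close>

lemma p_rsmult_J:
  assumes b: "b \<in> J" and n: "n \<in> carrier N" "\<And>m. m \<in> carrier M \<Longrightarrow> p n m \<in> ideal_power A I k"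
    and m: "m \<in> carrier M"
  shows "p (n \<odot>r\<^bsub>N\<^esub> b) m \<in> ideal_power A I (Suc k)"
  using b
proof (induction rule: pairing_span.induct)
  case (val m' n')
  have "p (n \<odot>r\<^bsub>N\<^esub> q m' n') m = p n m' \<otimes>\<^bsub>A\<^esub> p n' m"
    using val n(1) m by (simp add: p_smult flip: p_q)
  also have "\<dots> \<in> ideal_power A I (Suc k)"
    by (rule I_power_mult) (use val n m in \<open>auto intro: pairing_span.val\<close>)
  finally show ?case .
next
  case (sum b b')
  have "b \<in> carrier B" "b' \<in> carrier B"
    using sum morita_pairing.I_carrier[OF swap] by auto
  then have "p (n \<odot>r\<^bsub>N\<^esub> (b \<oplus>\<^bsub>B\<^esub> b')) m = p (n \<odot>r\<^bsub>N\<^esub> b) m \<oplus>\<^bsub>A\<^esub> p (n \<odot>r\<^bsub>N\<^esub> b') m"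
    using n m by (simp add: N.rsmult_r_distr p_add_left)
  with sum show ?case by (metis A.ideal_power_add)
qed

text \<open>
  The filtration of the off-diagonal entries is phrased through the values of the pairings, so that
  no additive span of products of bimodule elements is needed.
\<close>

definition N_filt where
  "N_filt k = {n \<in> carrier N. \<forall>m \<in> carrier M. p n m \<in> ideal_power A I k}"

definition M_filt where
  "M_filt k = {m \<in> carrier M. \<forall>n \<in> carrier N. q m n \<in> ideal_power B J k}"

text \<open>A diagonal entry of a product: the factor \<open>g\<close> raises the first summand by
  one level, while the second inherits the off-diagonal level \<open>k\<close>.\<close>

lemma filt_step_A:
  assumes "a \<in> ideal_power A I j" "n \<in> N_filt k" "g \<in> I" "m \<in> carrier M" "i \<le> Suc j" "i \<le> k"
  shows "a \<otimes>\<^bsub>A\<^esub> g \<oplus>\<^bsub>A\<^esub> p n m \<in> ideal_power A I i"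
proof (rule A.ideal_power_add)
  show "a \<otimes>\<^bsub>A\<^esub> g \<in> ideal_power A I i"
    by (rule I_power_mono[OF I_power_mult[OF assms(1,3)] assms(5)])
  show "p n m \<in> ideal_power A I i"
    using assms(2,4) by (intro I_power_mono[OF _ assms(6)]) (simp add: N_filt_def)
qed

text \<open>An off-diagonal entry of a product, tested against \<open>m\<close>: the first summand
  becomes \<open>a\<close> times \<open>p n' m\<close>, one level above \<open>j\<close>, and the
  second rises above \<open>k\<close> by \<open>p_rsmult_J\<close>.\<close>

lemma filt_step_N:
  assumes "a \<in> ideal_power A I j" "n \<in> N_filt k" "n' \<in> carrier N" "b \<in> J" "l \<le> Suc j" "l \<le> Suc k"
  shows "(a \<odot>\<^bsub>N\<^esub> n') \<oplus>\<^bsub>N\<^esub> (n \<odot>r\<^bsub>N\<^esub> b) \<in> N_filt l"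
proof -
  have n: "n \<in> carrier N" "\<And>m. m \<in> carrier M \<Longrightarrow> p n m \<in> ideal_power A I k"
    using assms(2) by (auto simp: N_filt_def)
  have a: "a \<in> carrier A" using assms(1) I_power_carrier by blast
  have b: "b \<in> carrier B" using assms(4) morita_pairing.I_carrier[OF swap] by blast
  have "p ((a \<odot>\<^bsub>N\<^esub> n') \<oplus>\<^bsub>N\<^esub> (n \<odot>r\<^bsub>N\<^esub> b)) m \<in> ideal_power A I l" if m: "m \<in> carrier M" for m
  proof -
    have "p ((a \<odot>\<^bsub>N\<^esub> n') \<oplus>\<^bsub>N\<^esub> (n \<odot>r\<^bsub>N\<^esub> b)) m = a \<otimes>\<^bsub>A\<^esub> p n' m \<oplus>\<^bsub>A\<^esub> p (n \<odot>r\<^bsub>N\<^esub> b) m"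
      using a b n m assms(3) by (simp add: p_add_left p_smult)
    also have "\<dots> \<in> ideal_power A I l"
      by (rule A.ideal_power_add[OF
            I_power_mono[OF I_power_mult[OF assms(1) pairing_span.val[OF assms(3) m]] assms(5)]
            I_power_mono[OF p_rsmult_J[OF assms(4) n m] assms(6)]])
    finally show ?thesis .
  qed
  then show ?thesis using a b n assms(3) by (simp add: N_filt_def)
qed

text \<open>Diagonal and off-diagonal entries carry separate levels because they rise in alternate
  multiplications.\<close>

definition T_filt where
  "T_filt j k = ideal_power A I j \<times> N_filt k \<times> M_filt k \<times> ideal_power B J j"

lemma M_filt_swap: "M_filt = morita_pairing.N_filt B N M q"
  by (rule ext) (simp add: M_filt_def morita_pairing.N_filt_def[OF swap])

lemma T_filt_step:
  assumes w: "w \<in> T_filt j k" and z: "z \<in> I \<times> carrier N \<times> carrier M \<times> J"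
    and le: "i \<le> Suc j" "i \<le> k" "l \<le> Suc j" "l \<le> Suc k"
  shows "w \<otimes>\<^bsub>T\<^esub> z \<in> T_filt i l"
proof -
  obtain a n m b where w': "w = (a, n, m, b)" "a \<in> ideal_power A I j" "n \<in> N_filt k"
      "m \<in> M_filt k" "b \<in> ideal_power B J j"
    using w by (auto simp: T_filt_def)
  obtain g n' m' h where z': "z = (g, n', m', h)" "g \<in> I" "n' \<in> carrier N" "m' \<in> carrier M" "h \<in> J"
    using z by auto
  have carr: "b \<in> carrier B" "h \<in> carrier B" "g \<in> carrier A" "m \<in> carrier M"
    using w' z' morita_pairing.I_power_carrier[OF swap] morita_pairing.I_carrier[OF swap]
    by (auto simp: M_filt_def)
  have "a \<otimes>\<^bsub>A\<^esub> g \<oplus>\<^bsub>A\<^esub> p n m' \<in> ideal_power A I i"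
    by (rule filt_step_A[where k = k]) (use w' z' le in auto)
  moreover have "(a \<odot>\<^bsub>N\<^esub> n') \<oplus>\<^bsub>N\<^esub> (n \<odot>r\<^bsub>N\<^esub> h) \<in> N_filt l"
    by (rule filt_step_N[where k = k]) (use w' z' le in auto)
  \<comment> \<open>The remaining two entries are the first two of the swapped pairing. Their
    summands appear in the opposite order, which commutativity of addition repairs at the
    end.\<close>
  moreover have "b \<otimes>\<^bsub>B\<^esub> h \<oplus>\<^bsub>B\<^esub> q m n' \<in> ideal_power B J i"
    by (rule morita_pairing.filt_step_A[OF swap, where k = k]) (use w' z' le M_filt_swap in auto)
  moreover have "(b \<odot>\<^bsub>M\<^esub> m') \<oplus>\<^bsub>M\<^esub> (m \<odot>r\<^bsub>M\<^esub> g) \<in> M_filt l"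
    unfolding M_filt_swap
    by (rule morita_pairing.filt_step_N[OF swap, where k = k]) (use w' z' le M_filt_swap in auto)
  ultimately show ?thesis
    using carr z' by (simp add: w'(1) z'(1) T_filt_def B.a_comm M.a_comm)
qed

lemma T_filt_power:
  assumes z: "z \<in> I \<times> carrier N \<times> carrier M \<times> J"
  shows "z [^]\<^bsub>T\<^esub> (2 * k) \<in> T_filt k k"
proof (induction k)
  case 0
  then show ?case by (simp add: T_filt_def N_filt_def M_filt_def nat_pow_def)
next
  case (Suc k)
  have "z \<in> carrier T"
    using z I_carrier morita_pairing.I_carrier[OF swap] by (auto simp: T_def)
  then have "z [^]\<^bsub>T\<^esub> (2 * Suc k) = z [^]\<^bsub>T\<^esub> (2 * k) \<otimes>\<^bsub>T\<^esub> z \<otimes>\<^bsub>T\<^esub> z"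
    by (simp add: nat_pow_def)
  \<comment> \<open>The first factor \<open>z\<close> lifts the levels from \<open>k\<close>,
    \<open>k\<close> to \<open>k\<close>, \<open>Suc k\<close>; the second lifts the diagonal to
    \<open>Suc k\<close> as well.\<close>
  also have "\<dots> \<in> T_filt (Suc k) (Suc k)"
    by (rule T_filt_step[where j = k and k = "Suc k"], rule T_filt_step[where j = k and k = k])
      (use Suc z in auto)
  finally show ?case .
qed

text \<open>At level \<open>k\<close> the diagonal entries vanish, whereas the off-diagonal ones
  merely pair to zero. One squaring removes them, which turns the exponent \<open>2 * k\<close> into
  \<open>4 * k\<close>.\<close>

lemma T_nilpotent:
  assumes z: "z \<in> I \<times> carrier N \<times> carrier M \<times> J"
    and zero: "ideal_power A I k \<subseteq> {\<zero>\<^bsub>A\<^esub>}" "ideal_power B J k \<subseteq> {\<zero>\<^bsub>B\<^esub>}"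
  shows "z [^]\<^bsub>T\<^esub> (4 * k) = \<zero>\<^bsub>T\<^esub>"
proof -
  interpret T: ring T by (rule ring_T)
  obtain a n m b where eq: "z [^]\<^bsub>T\<^esub> (2 * k) = (a, n, m, b)" by (cases "z [^]\<^bsub>T\<^esub> (2 * k)")
  with T_filt_power[OF z, of k] have mem: "a \<in> ideal_power A I k" "n \<in> N_filt k" "m \<in> M_filt k" "b \<in> ideal_power B J k"
    by (auto simp: T_filt_def)
  with zero have "a = \<zero>\<^bsub>A\<^esub>" "b = \<zero>\<^bsub>B\<^esub>" "n \<in> carrier N" "m \<in> carrier M" "p n m = \<zero>\<^bsub>A\<^esub>" "q m n = \<zero>\<^bsub>B\<^esub>"
    by (auto simp: N_filt_def M_filt_def)
  then have "(a, n, m, b) \<otimes>\<^bsub>T\<^esub> (a, n, m, b) = \<zero>\<^bsub>T\<^esub>" by simp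
  moreover have "z \<in> carrier T"
    using z I_carrier morita_pairing.I_carrier[OF swap] by (auto simp: T_def)
  then have "z [^]\<^bsub>T\<^esub> (4 * k) = z [^]\<^bsub>T\<^esub> (2 * k) \<otimes>\<^bsub>T\<^esub> z [^]\<^bsub>T\<^esub> (2 * k)"
    by (simp add: T.nat_pow_mult)
  ultimately show ?thesis by (simp add: eq)
qed

section \<open>Periodicity of the ring of pairings\<close>

text \<open>Taking diagonals is multiplicative modulo \<open>I\<close> and \<open>J\<close>, since
  the correction terms are values of the pairings. The errors \<open>g\<close> and \<open>h\<close>
  are explicit, which replaces passing to quotient rings.\<close>

lemma T_power_diag:
  assumes "a \<in> carrier A" "n \<in> carrier N" "m \<in> carrier M" "b \<in> carrier B"
  obtains g n' m' h where "g \<in> I" "n' \<in> carrier N" "m' \<in> carrier M" "h \<in> J"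
    "(a, n, m, b) [^]\<^bsub>T\<^esub> (r :: nat) = (a [^]\<^bsub>A\<^esub> r \<oplus>\<^bsub>A\<^esub> g, n', m', b [^]\<^bsub>B\<^esub> r \<oplus>\<^bsub>B\<^esub> h)"
proof -
  interpret T: ring T by (rule ring_T)
  show thesis using that
  proof (induction r arbitrary: thesis)
    case 0
    show ?case
      by (rule 0[of "\<zero>\<^bsub>A\<^esub>" "\<zero>\<^bsub>N\<^esub>" "\<zero>\<^bsub>M\<^esub>" "\<zero>\<^bsub>B\<^esub>"]) (simp_all add: I_zero morita_pairing.I_zero[OF swap] nat_pow_def)
  next
    case (Suc r)
    obtain g n' m' h where IH: "g \<in> I" "n' \<in> carrier N" "m' \<in> carrier M" "h \<in> J"
      "(a, n, m, b) [^]\<^bsub>T\<^esub> r = (a [^]\<^bsub>A\<^esub> r \<oplus>\<^bsub>A\<^esub> g, n', m', b [^]\<^bsub>B\<^esub> r \<oplus>\<^bsub>B\<^esub> h)"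
      using Suc.IH by blast
    have h: "h \<in> carrier B" using IH(4) morita_pairing.I_carrier[OF swap] by blast
    have "(a, n, m, b) [^]\<^bsub>T\<^esub> Suc r = (a [^]\<^bsub>A\<^esub> r \<oplus>\<^bsub>A\<^esub> g, n', m', b [^]\<^bsub>B\<^esub> r \<oplus>\<^bsub>B\<^esub> h) \<otimes>\<^bsub>T\<^esub> (a, n, m, b)"
      by (simp add: T.nat_pow_Suc flip: IH(5))
    also have "\<dots> = (a [^]\<^bsub>A\<^esub> Suc r \<oplus>\<^bsub>A\<^esub> (g \<otimes>\<^bsub>A\<^esub> a \<oplus>\<^bsub>A\<^esub> p n' m), (a [^]\<^bsub>A\<^esub> r \<oplus>\<^bsub>A\<^esub> g) \<odot>\<^bsub>N\<^esub> n \<oplus>\<^bsub>N\<^esub> n' \<odot>r\<^bsub>N\<^esub> b,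
        m' \<odot>r\<^bsub>M\<^esub> a \<oplus>\<^bsub>M\<^esub> (b [^]\<^bsub>B\<^esub> r \<oplus>\<^bsub>B\<^esub> h) \<odot>\<^bsub>M\<^esub> m, b [^]\<^bsub>B\<^esub> Suc r \<oplus>\<^bsub>B\<^esub> (h \<otimes>\<^bsub>B\<^esub> b \<oplus>\<^bsub>B\<^esub> q m' n))"
      using assms IH h by (simp add: A.l_distr B.l_distr A.a_assoc B.a_assoc B.a_ac)
    finally show ?case
      by (intro Suc.prems)
        (use assms IH h in \<open>auto intro!: pairing_span.sum pairing_span.val I_rsmult morita_pairing.I_rsmult[OF swap]\<close>)
  qed
qed

lemma add_pow_T_one: "add_pow T (c :: nat) \<one>\<^bsub>T\<^esub> = (add_pow A c \<one>\<^bsub>A\<^esub>, \<zero>\<^bsub>N\<^esub>, \<zero>\<^bsub>M\<^esub>, add_pow B c \<one>\<^bsub>B\<^esub>)"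
proof -
  interpret T: ring T by (rule ring_T)
  show ?thesis by (induction c) simp_all
qed

lemma periodic_T:
  assumes "periodic_ring A" "periodic_ring B"
    and zero: "ideal_power A I k \<subseteq> {\<zero>\<^bsub>A\<^esub>}" "ideal_power B J k \<subseteq> {\<zero>\<^bsub>B\<^esub>}"
  shows "periodic_ring T"
proof -
  interpret T: ring T by (rule ring_T)
  show ?thesis
  proof unfold_locales
    fix t assume t: "t \<in> carrier T"
    then obtain a n m b where t_eq: "t = (a, n, m, b)"
      and carr: "a \<in> carrier A" "n \<in> carrier N" "m \<in> carrier M" "b \<in> carrier B"
      by (cases t) auto
    obtain r1 e1 where e1: "(0::nat) < e1" "\<And>r k. r1 \<le> r \<Longrightarrow> a [^]\<^bsub>A\<^esub> (r + k * e1) = a [^]\<^bsub>A\<^esub> r"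
      using periodic_ring.eventual_period[OF assms(1) carr(1)] by blast
    obtain r2 e2 where e2: "(0::nat) < e2" "\<And>r k. r2 \<le> r \<Longrightarrow> b [^]\<^bsub>B\<^esub> (r + k * e2) = b [^]\<^bsub>B\<^esub> r"
      using periodic_ring.eventual_period[OF assms(2) carr(4)] by blast
    \<comment> \<open>Beyond both preperiods, and positive because of \<open>Suc\<close>.\<close>
    define r where "r = Suc (r1 + r2)"
    \<comment> \<open>The product \<open>e1 * e2\<close> is a common period of the two diagonal
      entries.\<close>
    define s where "s = r + e1 * e2"
    have pow_eq: "a [^]\<^bsub>A\<^esub> s = a [^]\<^bsub>A\<^esub> r" "b [^]\<^bsub>B\<^esub> s = b [^]\<^bsub>B\<^esub> r"
      unfolding s_def using e1(2)[of r e2] e2(2)[of r e1] by (simp_all add: r_def mult.commute)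
    obtain g n1 m1 h where x: "g \<in> I" "n1 \<in> carrier N" "m1 \<in> carrier M" "h \<in> J"
      "t [^]\<^bsub>T\<^esub> r = (a [^]\<^bsub>A\<^esub> r \<oplus>\<^bsub>A\<^esub> g, n1, m1, b [^]\<^bsub>B\<^esub> r \<oplus>\<^bsub>B\<^esub> h)"
      unfolding t_eq by (rule T_power_diag[OF carr])
    obtain g' n2 m2 h' where y: "g' \<in> I" "n2 \<in> carrier N" "m2 \<in> carrier M" "h' \<in> J"
      "t [^]\<^bsub>T\<^esub> s = (a [^]\<^bsub>A\<^esub> r \<oplus>\<^bsub>A\<^esub> g', n2, m2, b [^]\<^bsub>B\<^esub> r \<oplus>\<^bsub>B\<^esub> h')"
      unfolding t_eq pow_eq[symmetric] by (rule T_power_diag[OF carr])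
    \<comment> \<open>This is the difference of the \<open>s\<close>-th and \<open>r\<close>-th
      powers of \<open>t\<close>. The equal powers of \<open>a\<close> and of \<open>b\<close>
      cancel on the diagonal, leaving errors in \<open>I\<close> and \<open>J\<close>.\<close>
    define w where "w = (g' \<ominus>\<^bsub>A\<^esub> g, n2 \<ominus>\<^bsub>N\<^esub> n1, m2 \<ominus>\<^bsub>M\<^esub> m1, h' \<ominus>\<^bsub>B\<^esub> h)"
    have h: "h \<in> carrier B" "h' \<in> carrier B"
      using x(4) y(4) morita_pairing.I_carrier[OF swap] by auto
    have w: "w \<in> I \<times> carrier N \<times> carrier M \<times> J" "w \<in> carrier T"
      unfolding w_def using x y h I_minus morita_pairing.I_minus[OF swap] by auto
    have sum: "t [^]\<^bsub>T\<^esub> s = t [^]\<^bsub>T\<^esub> r \<oplus>\<^bsub>T\<^esub> w"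
      unfolding x(5) y(5) w_def using x y h carr
      by (simp add: A.add_minus_cancel B.add_minus_cancel M.add_minus_cancel N.add_minus_cancel A.a_assoc B.a_assoc)
    \<comment> \<open>Powers of \<open>t\<close> commute; expanding the \<open>s\<close>-th one by
      \<open>sum\<close> and cancelling the square of the \<open>r\<close>-th one leaves the claim
      for \<open>w\<close>.\<close>
    have comm: "t [^]\<^bsub>T\<^esub> r \<otimes>\<^bsub>T\<^esub> w = w \<otimes>\<^bsub>T\<^esub> t [^]\<^bsub>T\<^esub> r"
    proof -
      have "t [^]\<^bsub>T\<^esub> r \<otimes>\<^bsub>T\<^esub> t [^]\<^bsub>T\<^esub> s = t [^]\<^bsub>T\<^esub> s \<otimes>\<^bsub>T\<^esub> t [^]\<^bsub>T\<^esub> r"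
        using t by (simp add: T.nat_pow_comm)
      then show ?thesis unfolding sum using t w(2) by (simp add: T.l_distr T.r_distr T.add.Units_l_cancel[unfolded T.add.Units_eq])
    qed
    obtain c1 :: nat where c1: "0 < c1" "add_pow A c1 \<one>\<^bsub>A\<^esub> = \<zero>\<^bsub>A\<^esub>"
      by (rule periodic_ring.finite_characteristic[OF assms(1)])
    obtain c2 :: nat where c2: "0 < c2" "add_pow B c2 \<one>\<^bsub>B\<^esub> = \<zero>\<^bsub>B\<^esub>"
      by (rule periodic_ring.finite_characteristic[OF assms(2)])
    \<comment> \<open>The product annihilates both identities, hence also the identity of
      \<open>T\<close>.\<close>
    define c where "c = c1 * c2"
    have "add_pow A c \<one>\<^bsub>A\<^esub> = \<zero>\<^bsub>A\<^esub>" "add_pow B c \<one>\<^bsub>B\<^esub> = \<zero>\<^bsub>B\<^esub>"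
      unfolding c_def using c1(2) c2(2) A.add.nat_pow_pow[of "\<one>\<^bsub>A\<^esub>" c2 c1] B.add.nat_pow_pow[of "\<one>\<^bsub>B\<^esub>" c1 c2]
      by (simp_all add: mult.commute)
    then have c: "0 < c" "add_pow T c \<one>\<^bsub>T\<^esub> = \<zero>\<^bsub>T\<^esub>"
      using c1(1) c2(1) by (simp_all add: c_def add_pow_T_one del: T_simps(3))
    \<comment> \<open>The removal of \<open>w\<close> by \<open>pow_char_eq\<close> wants an
      exponent that is a power of two, and \<open>4 * k\<close> is below
      \<open>2 ^ (4 * k)\<close>.\<close>
    have "w [^]\<^bsub>T\<^esub> (2 ^ (4 * k) :: nat) = w [^]\<^bsub>T\<^esub> (4 * k + (2 ^ (4 * k) - 4 * k))"
      using less_exp[of "4 * k"] by simp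
    also have "\<dots> = \<zero>\<^bsub>T\<^esub> \<otimes>\<^bsub>T\<^esub> w [^]\<^bsub>T\<^esub> (2 ^ (4 * k) - 4 * k)"
      using T_nilpotent[OF w(1) zero] w(2) T.nat_pow_mult[OF w(2)] by metis
    finally have "w [^]\<^bsub>T\<^esub> (2 ^ (4 * k) :: nat) = \<zero>\<^bsub>T\<^esub>" using w(2) by (simp del: T_simps)
    then have "(t [^]\<^bsub>T\<^esub> s) [^]\<^bsub>T\<^esub> (c ^ (4 * k)) = (t [^]\<^bsub>T\<^esub> r) [^]\<^bsub>T\<^esub> (c ^ (4 * k))"
      unfolding sum using t w(2) comm c by (intro T.pow_char_eq) auto
    then have "t [^]\<^bsub>T\<^esub> (s * c ^ (4 * k)) = t [^]\<^bsub>T\<^esub> (r * c ^ (4 * k))"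
      using t by (simp add: T.nat_pow_pow)
    \<comment> \<open>The exponents stay positive and distinct after multiplication by the positive
      number \<open>c ^ (4 * k)\<close>.\<close>
    moreover have "0 < r" "0 < s" "s \<noteq> r" using e1(1) e2(1) by (auto simp: r_def s_def)
    ultimately show "\<exists>m n :: nat. 0 < m \<and> 0 < n \<and> m \<noteq> n \<and> t [^]\<^bsub>T\<^esub> m = t [^]\<^bsub>T\<^esub> n"
      using c(1) by (intro exI[of _ "s * c ^ (4 * k)"] exI[of _ "r * c ^ (4 * k)"]) simp
  qed
qed

section \<open>Periodicity of the corners\<close>

lemma diag_power:
  assumes "a \<in> carrier A" "b \<in> carrier B"
  shows "(a, \<zero>\<^bsub>N\<^esub>, \<zero>\<^bsub>M\<^esub>, b) [^]\<^bsub>T\<^esub> (r :: nat) = (a [^]\<^bsub>A\<^esub> r, \<zero>\<^bsub>N\<^esub>, \<zero>\<^bsub>M\<^esub>, b [^]\<^bsub>B\<^esub> r)"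
proof -
  interpret T: ring T by (rule ring_T)
  show ?thesis using assms by (induction r) simp_all
qed

text \<open>Diagonal matrices multiply entrywise, so a repeated power of one is a simultaneous
  repetition in both corners.\<close>

lemma periodic_corners:
  assumes "periodic_ring T"
  shows "periodic_ring A" "periodic_ring B"
proof -
  have *: "\<exists>m n :: nat. 0 < m \<and> 0 < n \<and> m \<noteq> n \<and> a [^]\<^bsub>A\<^esub> m = a [^]\<^bsub>A\<^esub> n \<and> b [^]\<^bsub>B\<^esub> m = b [^]\<^bsub>B\<^esub> n"
    if "a \<in> carrier A" "b \<in> carrier B" for a b
    using periodic_ring.periodic[OF assms, of "(a, \<zero>\<^bsub>N\<^esub>, \<zero>\<^bsub>M\<^esub>, b)"] that
    by (auto simp: diag_power)
  \<comment> \<open>The opposite corner is filled with zero.\<close>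
  show "periodic_ring A" by unfold_locales (use * B.zero_closed in blast)
  show "periodic_ring B" by unfold_locales (use * A.zero_closed in blast)
qed

end

section \<open>Morita contexts\<close>

context morita_context
begin

lemma bimodule_pair_NM: "bimodule_pair A B A N M"
  and bimodule_pair_MN: "bimodule_pair B A B M N"
  by (simp_all add: bimodule_pair_def M.bimodule_axioms N.bimodule_axioms)

lemma psi_simps:
  "t \<in> carrier (tensor_product B N M) \<Longrightarrow> \<psi> t \<in> carrier A"
  "\<lbrakk>t \<in> carrier (tensor_product B N M); u \<in> carrier (tensor_product B N M)\<rbrakk>
    \<Longrightarrow> \<psi> (t \<oplus>\<^bsub>tensor_product B N M\<^esub> u) = \<psi> t \<oplus>\<^bsub>A\<^esub> \<psi> u"
  "\<lbrakk>a \<in> carrier A; t \<in> carrier (tensor_product B N M)\<rbrakk>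
    \<Longrightarrow> \<psi> (a \<odot>\<^bsub>tensor_product B N M\<^esub> t) = a \<otimes>\<^bsub>A\<^esub> \<psi> t"
  "\<lbrakk>t \<in> carrier (tensor_product B N M); a \<in> carrier A\<rbrakk>
    \<Longrightarrow> \<psi> (t \<odot>r\<^bsub>tensor_product B N M\<^esub> a) = \<psi> t \<otimes>\<^bsub>A\<^esub> a"
  using psi_hom by (auto simp: bimodule_hom_def regular_bimodule_def)

lemma phi_simps:
  "t \<in> carrier (tensor_product A M N) \<Longrightarrow> \<phi> t \<in> carrier B"
  "\<lbrakk>t \<in> carrier (tensor_product A M N); u \<in> carrier (tensor_product A M N)\<rbrakk>
    \<Longrightarrow> \<phi> (t \<oplus>\<^bsub>tensor_product A M N\<^esub> u) = \<phi> t \<oplus>\<^bsub>B\<^esub> \<phi> u"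
  "\<lbrakk>b \<in> carrier B; t \<in> carrier (tensor_product A M N)\<rbrakk>
    \<Longrightarrow> \<phi> (b \<odot>\<^bsub>tensor_product A M N\<^esub> t) = b \<otimes>\<^bsub>B\<^esub> \<phi> t"
  "\<lbrakk>t \<in> carrier (tensor_product A M N); b \<in> carrier B\<rbrakk>
    \<Longrightarrow> \<phi> (t \<odot>r\<^bsub>tensor_product A M N\<^esub> b) = \<phi> t \<otimes>\<^bsub>B\<^esub> b"
  using phi_hom by (auto simp: bimodule_hom_def regular_bimodule_def)

text \<open>Each pairing law is a law of pure tensors transported by a bimodule homomorphism. The
  actions on tensors are introduced by reading their formulas from right to left.\<close>

lemma morita_pairing:
  "morita_pairing A B M N (\<lambda>n m. \<psi> (pure_tensor B N M n m)) (\<lambda>m n. \<phi> (pure_tensor A M N m n))"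
proof -
  interpret NM: bimodule_pair A B A N M by (rule bimodule_pair_NM)
  interpret MN: bimodule_pair B A B M N by (rule bimodule_pair_MN)
  show ?thesis
    by unfold_locales
      (simp_all add: psi_simps phi_simps psi_phi phi_psi
        NM.pure_tensor_add_left NM.pure_tensor_add_right NM.pure_tensor_balanced
        MN.pure_tensor_add_left MN.pure_tensor_add_right MN.pure_tensor_balanced
        flip: NM.smult_pure_tensor NM.pure_tensor_rsmult MN.smult_pure_tensor MN.pure_tensor_rsmult)
qed

text \<open>The image contains all values and is closed under sums by additivity of
  \<open>\<psi>\<close>. Through \<open>ideal_power_mono\<close>, vanishing of a power of the image
  passes to the span.\<close>

lemma pairing_span_psi:
  "pairing_span A (carrier N) (carrier M) (\<lambda>n m. \<psi> (pure_tensor B N M n m))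
    \<subseteq> \<psi> ` carrier (tensor_product B N M)"
proof
  interpret NM: bimodule_pair A B A N M by (rule bimodule_pair_NM)
  fix g assume "g \<in> pairing_span A (carrier N) (carrier M) (\<lambda>n m. \<psi> (pure_tensor B N M n m))"
  then show "g \<in> \<psi> ` carrier (tensor_product B N M)"
  proof induction
    case (sum g h)
    then obtain t u where "t \<in> carrier (tensor_product B N M)" "u \<in> carrier (tensor_product B N M)"
      "g = \<psi> t" "h = \<psi> u" by blast
    then show ?case by (metis NM.tensor_add_closed imageI psi_simps(2))
  qed simp
qed

lemma pairing_span_phi:
  "pairing_span B (carrier M) (carrier N) (\<lambda>m n. \<phi> (pure_tensor A M N m n))
    \<subseteq> \<phi> ` carrier (tensor_product A M N)"
proof
  interpret MN: bimodule_pair B A B M N by (rule bimodule_pair_MN)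
  fix g assume "g \<in> pairing_span B (carrier M) (carrier N) (\<lambda>m n. \<phi> (pure_tensor A M N m n))"
  then show "g \<in> \<phi> ` carrier (tensor_product A M N)"
  proof induction
    case (sum g h)
    then obtain t u where "t \<in> carrier (tensor_product A M N)" "u \<in> carrier (tensor_product A M N)"
      "g = \<phi> t" "h = \<phi> u" by blast
    then show ?case by (metis MN.tensor_add_closed imageI phi_simps(2))
  qed simp
qed

end

theorem theorem2p2:
  fixes A :: "('a, 'r) ring_scheme" and B :: "('b, 's) ring_scheme"
    and M :: "('b, 'a, 'm, 'x) bimodule_scheme" and N :: "('a, 'b, 'n, 'y) bimodule_scheme"
    and \<psi> :: "(('n \<times> 'm) \<Rightarrow>\<^sub>0 int) set \<Rightarrow> 'a" and \<phi> :: "(('m \<times> 'n) \<Rightarrow>\<^sub>0 int) set \<Rightarrow> 'b"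
  assumes "morita_context A B M N \<psi> \<phi>"
    and "nilpotent_ideal A (\<psi> ` carrier (tensor_product B N M))"
    and "nilpotent_ideal B (\<phi> ` carrier (tensor_product A M N))"
  shows "periodic_ring A \<and> periodic_ring B \<longleftrightarrow> periodic_ring (morita_ring A B M N \<psi> \<phi>)"
proof -
  interpret morita_context A B M N \<psi> \<phi> by (rule assms(1))
  interpret P: morita_pairing A B M N "\<lambda>n m. \<psi> (pure_tensor B N M n m)" "\<lambda>m n. \<phi> (pure_tensor A M N m n)"
    by (rule morita_pairing)
  \<comment> \<open>The swapped instance supplies the statements about powers of
    \<open>P.J\<close>.\<close>
  interpret P': morita_pairing B A N M "\<lambda>m n. \<phi> (pure_tensor A M N m n)" "\<lambda>n m. \<psi> (pure_tensor B N M n m)"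
    by (rule P.swap)
  have T: "morita_ring A B M N \<psi> \<phi> = P.T"
    unfolding morita_ring_def P.T_def by (rule refl)
  obtain k l where "ideal_power A (\<psi> ` carrier (tensor_product B N M)) k = {\<zero>\<^bsub>A\<^esub>}"
    "ideal_power B (\<phi> ` carrier (tensor_product A M N)) l = {\<zero>\<^bsub>B\<^esub>}"
    using assms(2,3) unfolding nilpotent_ideal_def by blast
  then have k: "ideal_power A P.I k \<subseteq> {\<zero>\<^bsub>A\<^esub>}" and l: "ideal_power B P.J l \<subseteq> {\<zero>\<^bsub>B\<^esub>}"
    using ideal_power_mono[OF pairing_span_psi] ideal_power_mono[OF pairing_span_phi] by blast+
  \<comment> \<open>Powers decrease, so \<open>k + l\<close> is a common exponent for both
    spans.\<close>
  have "ideal_power A P.I (k + l) \<subseteq> {\<zero>\<^bsub>A\<^esub>}" "ideal_power B P.J (k + l) \<subseteq> {\<zero>\<^bsub>B\<^esub>}"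
    using k l P.I_power_mono[of _ "k + l" k] P'.I_power_mono[of _ "k + l" l] by auto
  then show ?thesis
    unfolding T using P.periodic_T P.periodic_corners by blast
qed

end
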